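(* Let $V\in C^\infty(\mathbb{R}^2;\mathbb{R})$ have a unique nondegenerate global minimum at the origin with $V(0)=0$, let $V^{-1}([0,\epsilon])$ be compact for some sufficiently small $\epsilon>0$, and let $V(q_1,q_2)=V(q_1,-q_2)$. Let $v_1,v_2>0$, $U$, the normalized Taylor coefficients $a_{j,2k}$ ($j+2k\ge 3$), and the normalized Hamiltonian $H=\frac12\sum_{i=1}^2 v_i(x_i^2+\xi_i^2)+U(x_1,x_2)$ be associated with $V$ as in the context, and let $b_{r,k,\ell}$ be the coefficients of the quantum Birkhoff normal form of $H$. Assume that $v_1/v_2\notin\mathbb{Q}$ and $a_{30}\neq 0$. Given (i) the sign of $a_{30}$, and (ii) the sequence of normalized coefficients $\{a_{1,2k}\}_{k\ge 1}$, the first two layers of the quantum Birkhoff normal form, namely the coefficients $b_{0,k,\ell}$ and $b_{1,k,\ell}$ (for all $k,\ell$ for which they occur), determine the full Taylor series of $U$ at the origin, and hence the Taylor series of $V$ at the origin. Moreover, $$a_{30}^2=2v_1\,b_{1,0,0}+\frac{v_2^2}{v_1^2-4v_2^2}\,a_{12}^2 .$$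
   Context: **Normalized Hamiltonian.** Near the origin the Taylor expansion of $V$ is $$V(q_1,q_2)=\tfrac12(v_1^2q_1^2+v_2^2q_2^2)+\sum_{j+2k\ge3}c_{j,2k}\,q_1^jq_2^{2k},\qquad v_1,v_2>0.$$ Thus $v_1$ is the frequency tangent to the reflection axis $q_2=0$ and $v_2$ the frequency in the normal direction; this labeling is fixed. In the linear symplectic coordinates $x_i=v_i^{1/2}q_i$, $\xi_i=v_i^{-1/2}p_i$, the symbol $\frac12\|p\|^2+V(q)$ of $-\frac{\hbar^2}{2}\Delta+V$ becomes $H=H_2+U(x_1,x_2)$ with $$H_2=\tfrac12\sum_{i=1}^2v_i(x_i^2+\xi_i^2),\qquad U=\sum_{j+2k\ge3}a_{j,2k}\,x_1^jx_2^{2k},\qquad a_{j,2k}=c_{j,2k}v_1^{-j/2}v_2^{-k}$$ (Taylor expansions at $0$). Here $a_{30}=a_{3,0}$ and $a_{12}=a_{1,2}$. Write $H=H_2+U_3+U_4+\cdots$ (formally), $U_m$ homogeneous of degree $m$ in $x$. **Moyal product.** For symbols (or formal power series) $A,B$ in $(x,\xi)\in\mathbb{R}^{4}$ and $j\ge0$ put $$\{A,B\}_j=\left.(\partial_x\cdot\partial_\eta-\partial_\xi\cdot\partial_y)^jA(x,\xi)B(y,\eta)\right|_{(y,\eta)=(x,\xi)},\qquad A\star B=\sum_{j\ge0}\frac1{j!}\Big(\frac{\mathrm i\hbar}{2}\Big)^j\{A,B\}_j,$$ extended $\hbar$-linearly, and $[A,B]^\star=A\star B-B\star A=\operatorname{ad}^\star_A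 B$. $\{A,B\}=\{A,B\}_1$ is the Poisson bracket. **Weyl algebra.** $\mathcal W_m$ is the space of polynomials in $x,\xi,\hbar$ (complex coefficients) that are weighted homogeneous of degree $m$, where $\deg x_j=\deg\xi_j=1$, $\deg\hbar=2$; $\mathcal W=\prod_{m\ge0}\mathcal W_m$. **Resonant projection.** With $z_j=x_j+\mathrm i\xi_j$, $\bar z_j=x_j-\mathrm i\xi_j$, the resonant projection $\Pi$ keeps exactly the monomials $\hbar^rz^\alpha\bar z^\beta$ with $\alpha=\beta$ ($\alpha,\beta\in\mathbb{N}_0^2$) and kills the others. Set $\Omega_j=x_j^2+\xi_j^2=z_j\bar z_j$. **Quantum Birkhoff normal form (QBNF).** When $v_1/v_2\notin\mathbb{Q}$ there is a unique $S=S_3+S_4+\cdots$ with $S_m\in\mathcal W_m$ and $\Pi S_m=0$ such that $$B:=e^{\frac{\mathrm i}{\hbar}\operatorname{ad}^\star_S}H=H+\frac{\mathrm i}{\hbar}[S,H]^\star+\frac1{2!}\Big(\frac{\mathrm i}{\hbar}\Big)^2[S,[S,H]^\star]^\star+\cdots$$ satisfies $\Pi B=B$. It has the form $$B=H_2+\sum_{2r+k+\ell\ge2}b_{r,k,\ell}\,\hbar^{2r}\Omega_1^k\Omega_2^\ell ,$$ which is the QBNF of $H$ and defines the coefficients $b_{r,k,\ell}$. **Meaning of "determine".** For fixed $v_1,v_2$ (they are part of the normal form through $H_2$): if two potentials as in the claim have the same $v_1,v_2$, the same sign of $a_{30}$, the same sequence $\{a_{1,2k}\}_{k\ge1}$,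 and the same coefficients $b_{0,k,\ell}$ and $b_{1,k,\ell}$ for all $k,\ell$, then all their coefficients $a_{j,2k}$ (equivalently $c_{j,2k}$) coincide. *)

theory Defs
  imports "HOL-Analysis.Analysis" "HOL-Computational_Algebra.Formal_Power_Series"
begin

unbundle no vec_syntax
unbundle fps_syntax

section \<open>Potentials on the plane\<close>

definition pd1 :: "(real \<times> real \<Rightarrow> real) \<Rightarrow> real \<times> real \<Rightarrow> real" where
  "pd1 f q = deriv (\<lambda>t. f (t, snd q)) (fst q)"

definition pd2 :: "(real \<times> real \<Rightarrow> real) \<Rightarrow> real \<times> real \<Rightarrow> real" where
  "pd2 f q = deriv (\<lambda>t. f (fst q, t)) (snd q)"

primrec Ck :: "nat \<Rightarrow> (real \<times> real \<Rightarrow> real) \<Rightarrow> bool" where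
  "Ck 0 f \<longleftrightarrow> continuous_on UNIV f"
| "Ck (Suc k) f \<longleftrightarrow> (\<forall>q. f differentiable (at q)) \<and> Ck k (pd1 f) \<and> Ck k (pd2 f)"

definition smooth :: "(real \<times> real \<Rightarrow> real) \<Rightarrow> bool" where
  "smooth f \<longleftrightarrow> (\<forall>k. Ck k f)"

definition taylor :: "(real \<times> real \<Rightarrow> real) \<Rightarrow> nat \<Rightarrow> nat \<Rightarrow> real" where
  "taylor V j m = (pd1 ^^ j) ((pd2 ^^ m) V) (0, 0) / (fact j * fact m)"

definition symmetric_well :: "(real \<times> real \<Rightarrow> real) \<Rightarrow> bool" where
  "symmetric_well V \<longleftrightarrow>
     smooth V \<and>
     V (0, 0) = 0 \<and>
     (\<forall>q. q \<noteq> (0, 0) \<longrightarrow> V (0, 0) < V q) \<and>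
     pd1 (pd1 V) (0, 0) * pd2 (pd2 V) (0, 0) - pd1 (pd2 V) (0, 0) * pd2 (pd1 V) (0, 0) \<noteq> 0 \<and>
     (\<exists>\<epsilon>>0. compact (V -` {0..\<epsilon>})) \<and>
     (\<forall>q1 q2. V (q1, q2) = V (q1, - q2))"

text \<open>The remaining Taylor coefficients of order at most two vanish for a symmetric well.\<close>

definition frequencies :: "(real \<times> real \<Rightarrow> real) \<Rightarrow> real \<Rightarrow> real \<Rightarrow> bool" where
  "frequencies V v1 v2 \<longleftrightarrow>
     v1 > 0 \<and> v2 > 0 \<and> taylor V 2 0 = v1\<^sup>2 / 2 \<and> taylor V 0 2 = v2\<^sup>2 / 2"

text \<open>
  Coefficient of \<open>x\<^sub>1\<^sup>j x\<^sub>2\<^sup>m\<close> after the substitution \<open>q\<^sub>i = v\<^sub>i\<^sup>-\<^sup>1\<^sup>/\<^sup>2 x\<^sub>i\<close>; both indices are actual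
  exponents, so the normalized coefficient with index \<open>(j, 2k)\<close> is \<open>ncoef v1 v2 V j (2 * k)\<close>.
\<close>

definition ncoef :: "real \<Rightarrow> real \<Rightarrow> (real \<times> real \<Rightarrow> real) \<Rightarrow> nat \<Rightarrow> nat \<Rightarrow> real" where
  "ncoef v1 v2 V j m = taylor V j m * v1 powr (- real j / 2) * v2 powr (- real m / 2)"


section \<open>Formal symbols\<close>

text \<open>
  Formal power series over the complex numbers in \<open>\<hbar>, x\<^sub>1, x\<^sub>2, \<xi>\<^sub>1, \<xi>\<^sub>2\<close>, from the outermost
  to the innermost variable.
\<close>

type_synonym symb = "complex fps fps fps fps fps"

definition coef :: "symb \<Rightarrow> nat \<Rightarrow> nat \<Rightarrow> nat \<Rightarrow> nat \<Rightarrow> nat \<Rightarrow> complex" where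
  "coef A r a1 a2 b1 b2 = A $ r $ a1 $ a2 $ b1 $ b2"

definition symb_of :: "(nat \<Rightarrow> nat \<Rightarrow> nat \<Rightarrow> nat \<Rightarrow> nat \<Rightarrow> complex) \<Rightarrow> symb" where
  "symb_of c = Abs_fps (\<lambda>r. Abs_fps (\<lambda>a1. Abs_fps (\<lambda>a2. Abs_fps (\<lambda>b1. Abs_fps (\<lambda>b2.
     c r a1 a2 b1 b2)))))"

text \<open>
  Formal sum of a locally finite family (each monomial occurs in only finitely many members).
\<close>

definition fsum :: "('i \<Rightarrow> symb) \<Rightarrow> symb" where
  "fsum F = symb_of (\<lambda>r a1 a2 b1 b2.
     \<Sum>i \<in> {i. coef (F i) r a1 a2 b1 b2 \<noteq> 0}. coef (F i) r a1 a2 b1 b2)"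

definition scal :: "complex \<Rightarrow> symb" where
  "scal c = fps_const (fps_const (fps_const (fps_const (fps_const c))))"

definition hbar :: symb where "hbar = fps_X"
definition X1 :: symb where "X1 = fps_const fps_X"
definition X2 :: symb where "X2 = fps_const (fps_const fps_X)"
definition Xi1 :: symb where "Xi1 = fps_const (fps_const (fps_const fps_X))"
definition Xi2 :: symb where "Xi2 = fps_const (fps_const (fps_const (fps_const fps_X)))"

definition coeffwise :: "('a \<Rightarrow> 'a) \<Rightarrow> 'a fps \<Rightarrow> 'a fps" where
  "coeffwise D A = Abs_fps (\<lambda>n. D (A $ n))"

definition dX1 :: "symb \<Rightarrow> symb" where
  "dX1 = coeffwise fps_deriv"
definition dX2 :: "symb \<Rightarrow> symb" where
  "dX2 = coeffwise (coeffwise fps_deriv)"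
definition dXi1 :: "symb \<Rightarrow> symb" where
  "dXi1 = coeffwise (coeffwise (coeffwise fps_deriv))"
definition dXi2 :: "symb \<Rightarrow> symb" where
  "dXi2 = coeffwise (coeffwise (coeffwise (coeffwise fps_deriv)))"


section \<open>Moyal product\<close>

text \<open>
  \<open>bidiff j A B\<close> is \<open>{A, B}\<^sub>j\<close>: one factor of the bidifferential operator
  \<open>\<partial>\<^sub>x \<cdot> \<partial>\<^sub>\<eta> - \<partial>\<^sub>\<xi> \<cdot> \<partial>\<^sub>y\<close> sends \<open>A(x,\<xi>) B(y,\<eta>)\<close> to a sum of four products of the same kind,
  to which the remaining factors are applied before restricting to the diagonal.
\<close>

primrec bidiff :: "nat \<Rightarrow> symb \<Rightarrow> symb \<Rightarrow> symb" where
  "bidiff 0 A B = A * B"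
| "bidiff (Suc j) A B =
     bidiff j (dX1 A) (dXi1 B) + bidiff j (dX2 A) (dXi2 B)
     - bidiff j (dXi1 A) (dX1 B) - bidiff j (dXi2 A) (dX2 B)"

definition moyal :: "symb \<Rightarrow> symb \<Rightarrow> symb" where
  "moyal A B = fsum (\<lambda>j. scal ((\<i> / 2) ^ j / fact j) * hbar ^ j * bidiff j A B)"

definition moyal_commutator :: "symb \<Rightarrow> symb \<Rightarrow> symb" where
  "moyal_commutator A B = moyal A B - moyal B A"

text \<open>
  \<open>(\<i> / \<hbar>) [S, A]\<close>: the Moyal commutator has no term of order \<open>\<hbar>\<^sup>0\<close>, so dividing it by \<open>\<hbar>\<close>
  is a shift in the outermost variable.
\<close>

definition ad_over_hbar :: "symb \<Rightarrow> symb \<Rightarrow> symb" where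
  "ad_over_hbar S A = scal \<i> * fps_shift 1 (moyal_commutator S A)"

definition exp_ad :: "symb \<Rightarrow> symb \<Rightarrow> symb" where
  "exp_ad S A = fsum (\<lambda>n. scal (1 / fact n) * (ad_over_hbar S ^^ n) A)"


section \<open>Grading and resonant projection\<close>

definition hom_part :: "nat \<Rightarrow> symb \<Rightarrow> symb" where
  "hom_part m A = symb_of (\<lambda>r a1 a2 b1 b2.
     if 2 * r + a1 + a2 + b1 + b2 = m then coef A r a1 a2 b1 b2 else 0)"

definition zmon :: "nat \<Rightarrow> nat \<times> nat \<Rightarrow> nat \<times> nat \<Rightarrow> symb" where
  "zmon r \<alpha> \<beta> = hbar ^ r
     * (X1 + scal \<i> * Xi1) ^ fst \<alpha> * (X2 + scal \<i> * Xi2) ^ snd \<alpha>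
     * (X1 - scal \<i> * Xi1) ^ fst \<beta> * (X2 - scal \<i> * Xi2) ^ snd \<beta>"

definition zseries :: "(nat \<Rightarrow> nat \<times> nat \<Rightarrow> nat \<times> nat \<Rightarrow> complex) \<Rightarrow> symb" where
  "zseries c = fsum (\<lambda>(r, \<alpha>, \<beta>). scal (c r \<alpha> \<beta>) * zmon r \<alpha> \<beta>)"

text \<open>
  Every symbol has a unique expansion in the monomials \<open>\<hbar>\<^sup>r z\<^sup>\<alpha> z'\<^sup>\<beta>\<close>, where \<open>z = x + \<i>\<xi>\<close> and
  \<open>z' = x - \<i>\<xi>\<close>, because these are linear coordinates.
\<close>

definition zcoef :: "symb \<Rightarrow> nat \<Rightarrow> nat \<times> nat \<Rightarrow> nat \<times> nat \<Rightarrow> complex" where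
  "zcoef A = (THE c. A = zseries c)"

definition res_proj :: "symb \<Rightarrow> symb" where
  "res_proj A = zseries (\<lambda>r \<alpha> \<beta>. if \<alpha> = \<beta> then zcoef A r \<alpha> \<beta> else 0)"


section \<open>Quantum Birkhoff normal form\<close>

definition H2 :: "real \<Rightarrow> real \<Rightarrow> symb" where
  "H2 v1 v2 = scal (1 / 2) *
     (scal (of_real v1) * (X1\<^sup>2 + Xi1\<^sup>2) + scal (of_real v2) * (X2\<^sup>2 + Xi2\<^sup>2))"

definition U_series :: "real \<Rightarrow> real \<Rightarrow> (real \<times> real \<Rightarrow> real) \<Rightarrow> symb" where
  "U_series v1 v2 V = fsum (\<lambda>(j, k).
     if j + 2 * k \<ge> 3 then scal (of_real (ncoef v1 v2 V j (2 * k))) * X1 ^ j * X2 ^ (2 * k) else 0)"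

definition hamiltonian :: "real \<Rightarrow> real \<Rightarrow> (real \<times> real \<Rightarrow> real) \<Rightarrow> symb" where
  "hamiltonian v1 v2 V = H2 v1 v2 + U_series v1 v2 V"

definition qbnf_generator :: "symb \<Rightarrow> symb \<Rightarrow> bool" where
  "qbnf_generator H S \<longleftrightarrow>
     (\<forall>m<3. hom_part m S = 0) \<and>
     (\<forall>m\<ge>3. res_proj (hom_part m S) = 0) \<and>
     res_proj (exp_ad S H) = exp_ad S H"

definition qbnf :: "symb \<Rightarrow> symb" where
  "qbnf H = exp_ad (THE S. qbnf_generator H S) H"

text \<open>
  The coefficient of \<open>\<hbar>\<^sup>2\<^sup>r \<Omega>\<^sub>1\<^sup>k \<Omega>\<^sub>2\<^sup>l = \<hbar>\<^sup>2\<^sup>r z\<^sup>\<alpha> z'\<^sup>\<alpha>\<close>, \<open>\<alpha> = (k, l)\<close>. Only indices with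
  \<open>2 * r + k + l \<ge> 2\<close> are meant; the others belong to the quadratic part.
\<close>

definition qbnf_coef :: "real \<Rightarrow> real \<Rightarrow> (real \<times> real \<Rightarrow> real) \<Rightarrow> nat \<Rightarrow> nat \<Rightarrow> nat \<Rightarrow> complex" where
  "qbnf_coef v1 v2 V r k l = zcoef (qbnf (hamiltonian v1 v2 V)) (2 * r) (k, l) (k, l)"

end

theory Submission
  imports Defs
begin

text \<open>
  Let \<open>F\<^sub>m\<close> be the space of symbols all of whose monomials have weighted degree at least \<open>m\<close>, where
  \<open>\<hbar>\<close> has weight two (\<open>deg_ge m\<close>). The operator \<open>ad\<^sub>S = (\<i> / \<hbar>) [S, _]\<close> maps \<open>F\<^sub>n\<close> into
  \<open>F\<close> of index \<open>n + k - 2\<close> when \<open>S\<close> lies in \<open>F\<^sub>k\<close>. For \<open>S\<close> in \<open>F\<^sub>3\<close> the exponential is therefore,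
  modulo any \<open>F\<^sub>m\<close>, a finite sum of brackets. Moreover \<open>ad\<^sub>S H\<^sub>2 = - {S, H\<^sub>2}\<close>, and \<open>{_, H\<^sub>2}\<close>
  multiplies \<open>\<hbar>\<^sup>r z\<^sup>\<alpha> z'\<^sup>\<beta>\<close> by \<open>\<i> (v\<^sub>1 (\<beta>\<^sub>1 - \<alpha>\<^sub>1) + v\<^sub>2 (\<beta>\<^sub>2 - \<alpha>\<^sub>2))\<close>, which is nonzero off the
  resonances \<open>\<alpha> = \<beta>\<close>. So the generator can be solved for degree by degree, and uniquely
  (\<open>generator_exists\<close>, \<open>generators_agree\<close>).

  Now let \<open>U\<close> and \<open>U'\<close> agree below degree \<open>m\<close>, put \<open>u = U - U'\<close>, and let \<open>\<delta> = S - S'\<close> be the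
  difference of the generators and \<open>B\<close>, \<open>B'\<close> the normal forms. Then \<open>\<delta>\<close> lies in \<open>F\<^sub>m\<close> too, and
  \<open>B - B' = u - {\<delta>, H\<^sub>2}\<close> up to terms of degree above \<open>m\<close>. A bracket with \<open>H\<^sub>2\<close> has no resonant
  part. If \<open>m\<close> is even, the part of degree \<open>m\<close> of \<open>u\<close> consists of monomials
  \<open>x\<^sub>1\<^sup>2\<^sup>p x\<^sub>2\<^sup>2\<^sup>q\<close>, and the resonant part of each is a nonzero multiple of \<open>\<Omega>\<^sub>1\<^sup>p \<Omega>\<^sub>2\<^sup>q\<close>;
  equality of the layers \<open>b\<^sub>0\<close> gives \<open>u = 0\<close> in degree \<open>m\<close> (\<open>even_degree_step\<close>).

  In odd degree there are no resonances, and one has to look at degree \<open>m + 1\<close>. Because the cubic part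
  of \<open>{S', H\<^sub>2}\<close> is that of \<open>U'\<close> and \<open>{_, H\<^sub>2}\<close> is a derivation of the Moyal bracket, all
  second-order terms combine (\<open>second_order\<close>) into
  \<open>B - B' = u - {\<delta>, H\<^sub>2} + ad\<^bsub>S'\<^esub> u + {ad\<^sub>\<delta> S', H\<^sub>2} / 2\<close> up to terms of degree above \<open>m + 1\<close>.
  Only \<open>ad\<^bsub>S'\<^esub> u\<close> has a resonant part of order \<open>\<hbar>\<^sup>2\<close>, and in degree \<open>m + 1\<close> it only involves the cubic
  part \<open>s\<close> of \<open>S'\<close>, the explicit solution of \<open>{s, H\<^sub>2} = a\<^sub>3\<^sub>0 x\<^sub>1\<^sup>3 + a\<^sub>1\<^sub>2 x\<^sub>1 x\<^sub>2\<^sup>2\<close>. The order \<open>\<hbar>\<^sup>2\<close> of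
  \<open>ad\<^sub>s u\<close> is \<open>{s, u}\<^sub>3 / 24\<close>, and as \<open>u\<close> depends on the positions only,
  \<open>{s, u}\<^sub>3\<close> is a combination of \<open>\<partial>\<^sub>1\<^sup>3 u\<close>, with factor \<open>4 a\<^sub>3\<^sub>0 / v\<^sub>1\<close>, and of \<open>\<partial>\<^sub>1 \<partial>\<^sub>2\<^sup>2 u\<close>. Its
  resonant coefficients, read off from the layer \<open>b\<^sub>1\<close>, thus express the coefficient
  of \<open>x\<^sub>1\<^sup>2\<^sup>p\<^sup>+\<^sup>3 x\<^sub>2\<^sup>2\<^sup>q\<close> in \<open>u\<close> through that of \<open>x\<^sub>1\<^sup>2\<^sup>p\<^sup>+\<^sup>1 x\<^sub>2\<^sup>2\<^sup>q\<^sup>+\<^sup>2\<close>, since \<open>a\<^sub>3\<^sub>0 \<noteq> 0\<close>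
  (\<open>odd_degree_step\<close>). The prescribed row \<open>a\<^sub>1\<^sub>,\<^sub>2\<^sub>k\<close> starts this recursion.

  In degree three the same computation is carried out for a single potential:
  \<open>B = H\<^sub>2 + U - {S, H\<^sub>2} + ad\<^sub>S U / 2\<close> up to terms of degree above four, and the coefficient of \<open>\<hbar>\<^sup>2\<close> is the
  displayed formula for \<open>a\<^sub>3\<^sub>0\<^sup>2\<close>, which together with the sign determines \<open>a\<^sub>3\<^sub>0\<close>.
\<close>

section \<open>Coefficients and derivatives of formal symbols\<close>

lemma symb_eqI:
  assumes "\<And>r a1 a2 b1 b2. coef A r a1 a2 b1 b2 = coef B r a1 a2 b1 b2"
  shows "A = B"
  using assms unfolding coef_def by (auto simp: fps_eq_iff)

lemma coef_symb_of [simp]: "coef (symb_of c) r a1 a2 b1 b2 = c r a1 a2 b1 b2"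
  by (simp add: coef_def symb_of_def)

lemma coef_0 [simp]: "coef 0 r a1 a2 b1 b2 = 0"
  and coef_add [simp]: "coef (A + B) r a1 a2 b1 b2 = coef A r a1 a2 b1 b2 + coef B r a1 a2 b1 b2"
  and coef_diff [simp]: "coef (A - B) r a1 a2 b1 b2 = coef A r a1 a2 b1 b2 - coef B r a1 a2 b1 b2"
  and coef_uminus [simp]: "coef (- A) r a1 a2 b1 b2 = - coef A r a1 a2 b1 b2"
  and coef_scal_mult [simp]: "coef (scal c * A) r a1 a2 b1 b2 = c * coef A r a1 a2 b1 b2"
  by (simp_all add: coef_def scal_def)

lemma coef_sum [simp]: "coef (sum F I) r a1 a2 b1 b2 = (\<Sum>i\<in>I. coef (F i) r a1 a2 b1 b2)"
  by (simp add: coef_def fps_sum_nth)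

lemma coef_hbar_mult [simp]:
    "coef (hbar * A) r a1 a2 b1 b2 = (if r = 0 then 0 else coef A (r - 1) a1 a2 b1 b2)"
  and coef_X1_mult [simp]:
    "coef (X1 * A) r a1 a2 b1 b2 = (if a1 = 0 then 0 else coef A r (a1 - 1) a2 b1 b2)"
  and coef_X2_mult [simp]:
    "coef (X2 * A) r a1 a2 b1 b2 = (if a2 = 0 then 0 else coef A r a1 (a2 - 1) b1 b2)"
  and coef_Xi1_mult [simp]:
    "coef (Xi1 * A) r a1 a2 b1 b2 = (if b1 = 0 then 0 else coef A r a1 a2 (b1 - 1) b2)"
  and coef_Xi2_mult [simp]:
    "coef (Xi2 * A) r a1 a2 b1 b2 = (if b2 = 0 then 0 else coef A r a1 a2 b1 (b2 - 1))"
  by (simp_all add: coef_def hbar_def X1_def X2_def Xi1_def Xi2_def)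

lemma coef_hbar_power_mult [simp]:
  "coef (hbar ^ j * A) r a1 a2 b1 b2 = (if r < j then 0 else coef A (r - j) a1 a2 b1 b2)"
  by (simp add: coef_def hbar_def fps_X_power_mult_nth)

lemma coef_1: "coef 1 r a1 a2 b1 b2 = (if r = 0 \<and> a1 = 0 \<and> a2 = 0 \<and> b1 = 0 \<and> b2 = 0 then 1 else 0)"
  by (simp add: coef_def)

lemma coef_scal: "coef (scal c) r a1 a2 b1 b2 = (if r = 0 \<and> a1 = 0 \<and> a2 = 0 \<and> b1 = 0 \<and> b2 = 0 then c else 0)"
  by (simp add: coef_def scal_def)

lemma coef_dX1 [simp]:
    "coef (dX1 A) r a1 a2 b1 b2 = of_nat (Suc a1) * coef A r (Suc a1) a2 b1 b2"
  and coef_dX2 [simp]: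
    "coef (dX2 A) r a1 a2 b1 b2 = of_nat (Suc a2) * coef A r a1 (Suc a2) b1 b2"
  and coef_dXi1 [simp]:
    "coef (dXi1 A) r a1 a2 b1 b2 = of_nat (Suc b1) * coef A r a1 a2 (Suc b1) b2"
  and coef_dXi2 [simp]:
    "coef (dXi2 A) r a1 a2 b1 b2 = of_nat (Suc b2) * coef A r a1 a2 b1 (Suc b2)"
  by (simp_all add: coef_def dX1_def dX2_def dXi1_def dXi2_def coeffwise_def fps_of_nat[symmetric]
      del: of_nat_Suc)

lemma coef_shift [simp]: "coef (fps_shift n A) r a1 a2 b1 b2 = coef A (r + n) a1 a2 b1 b2"
  by (simp add: coef_def)

lemma coef_mult:
  "coef (A * B) r a1 a2 b1 b2 =
     (\<Sum>i=0..r. \<Sum>j1=0..a1. \<Sum>j2=0..a2. \<Sum>k1=0..b1. \<Sum>k2=0..b2.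
        coef A i j1 j2 k1 k2 * coef B (r - i) (a1 - j1) (a2 - j2) (b1 - k1) (b2 - k2))"
  by (simp add: coef_def fps_mult_nth fps_sum_nth)

lemma scal_0 [simp]: "scal 0 = 0" and scal_1 [simp]: "scal 1 = 1"
  and scal_add: "scal (c + d) = scal c + scal d"
  and scal_diff: "scal (c - d) = scal c - scal d"
  and scal_minus: "scal (- c) = - scal c"
  and scal_mult: "scal (c * d) = scal c * scal d"
  by (simp_all add: scal_def flip: fps_const_add fps_const_sub fps_const_mult fps_const_neg)

lemma of_nat_eq_scal: "of_nat n = scal (of_nat n)"
  by (simp add: scal_def fps_of_nat)

lemma numeral_eq_scal: "(numeral w :: symb) = scal (numeral w)"
  by (simp add: scal_def flip: numeral_fps_const)

lemma coef_numeral: "coef (numeral w) r a1 a2 b1 b2 =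
    (if r = 0 \<and> a1 = 0 \<and> a2 = 0 \<and> b1 = 0 \<and> b2 = 0 then numeral w else 0)"
  by (simp add: numeral_eq_scal coef_scal)

lemma coef_numeral_mult [simp]: "coef (numeral w * A) r a1 a2 b1 b2 = numeral w * coef A r a1 a2 b1 b2"
  by (metis numeral_eq_scal coef_scal_mult)

text \<open>
  The four derivatives are nested coefficientwise liftings of the formal derivative of one variable;
  each lifting preserves additivity and the product rule.
\<close>

lemma coeffwise_mult:
  fixes D :: "'a::comm_ring_1 \<Rightarrow> 'a"
  assumes add: "\<And>a b. D (a + b) = D a + D b"
    and mult: "\<And>a b. D (a * b) = D a * b + a * D b"
  shows "coeffwise D (A * B) = coeffwise D A * B + A * coeffwise D B"
proof (rule fps_ext)
  fix n
  have D0: "D 0 = 0" using add[of 0 0] by simp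
  have Dsum: "D (sum f I) = (\<Sum>i\<in>I. D (f i))" for f :: "nat \<Rightarrow> 'a" and I
    by (induction I rule: infinite_finite_induct) (simp_all add: add D0)
  show "coeffwise D (A * B) $ n = (coeffwise D A * B + A * coeffwise D B) $ n"
    by (simp add: coeffwise_def fps_mult_nth Dsum mult sum.distrib)
qed

lemma coeffwise_add:
  assumes add: "\<And>a b. D (a + b) = D a + D b"
  shows "coeffwise D (A + B) = coeffwise D A + coeffwise D B"
  by (simp add: fps_eq_iff coeffwise_def add)

lemma d_mult:
  shows dX1_mult: "dX1 (A * B) = dX1 A * B + A * dX1 B"
    and dX2_mult: "dX2 (A * B) = dX2 A * B + A * dX2 B"
    and dXi1_mult: "dXi1 (A * B) = dXi1 A * B + A * dXi1 B"
    and dXi2_mult: "dXi2 (A * B) = dXi2 A * B + A * dXi2 B"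
  unfolding dX1_def dX2_def dXi1_def dXi2_def
  by (intro coeffwise_mult coeffwise_add; simp)+

lemma d_linear [simp]:
  "dX1 (A + B) = dX1 A + dX1 B" "dX1 (A - B) = dX1 A - dX1 B" "dX1 (- A) = - dX1 A"
  "dX1 (scal c * A) = scal c * dX1 A" "dX1 0 = 0" "dX1 (scal c) = 0"
  "dX2 (A + B) = dX2 A + dX2 B" "dX2 (A - B) = dX2 A - dX2 B" "dX2 (- A) = - dX2 A"
  "dX2 (scal c * A) = scal c * dX2 A" "dX2 0 = 0" "dX2 (scal c) = 0"
  "dXi1 (A + B) = dXi1 A + dXi1 B" "dXi1 (A - B) = dXi1 A - dXi1 B" "dXi1 (- A) = - dXi1 A"
  "dXi1 (scal c * A) = scal c * dXi1 A" "dXi1 0 = 0" "dXi1 (scal c) = 0"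
  "dXi2 (A + B) = dXi2 A + dXi2 B" "dXi2 (A - B) = dXi2 A - dXi2 B" "dXi2 (- A) = - dXi2 A"
  "dXi2 (scal c * A) = scal c * dXi2 A" "dXi2 0 = 0" "dXi2 (scal c) = 0"
  by (rule symb_eqI; simp add: ring_distribs coef_scal)+

lemma d_numeral [simp]:
  "dX1 (numeral w) = 0" "dX2 (numeral w) = 0" "dXi1 (numeral w) = 0" "dXi2 (numeral w) = 0"
proof -
  have "numeral w = scal (numeral w)" by (rule numeral_eq_scal)
  then show "dX1 (numeral w) = 0" "dX2 (numeral w) = 0" "dXi1 (numeral w) = 0" "dXi2 (numeral w) = 0"
    by (metis d_linear)+
qed

lemma d_const [simp]: "dX1 1 = 0" "dX2 1 = 0" "dXi1 1 = 0" "dXi2 1 = 0"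
  by (rule symb_eqI; simp add: coef_1)+

lemma d_generators [simp]:
  "dX1 X1 = 1" "dX1 X2 = 0" "dX1 Xi1 = 0" "dX1 Xi2 = 0" "dX1 hbar = 0"
  "dX2 X1 = 0" "dX2 X2 = 1" "dX2 Xi1 = 0" "dX2 Xi2 = 0" "dX2 hbar = 0"
  "dXi1 X1 = 0" "dXi1 X2 = 0" "dXi1 Xi1 = 1" "dXi1 Xi2 = 0" "dXi1 hbar = 0"
  "dXi2 X1 = 0" "dXi2 X2 = 0" "dXi2 Xi1 = 0" "dXi2 Xi2 = 1" "dXi2 hbar = 0"
  using coef_X1_mult[of 1] coef_X2_mult[of 1] coef_Xi1_mult[of 1] coef_Xi2_mult[of 1] coef_hbar_mult[of 1]
  by (auto intro!: symb_eqI simp: coef_1)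

lemma d_commute:
  "dX2 (dX1 A) = dX1 (dX2 A)" "dXi1 (dX1 A) = dX1 (dXi1 A)" "dXi2 (dX1 A) = dX1 (dXi2 A)"
  "dXi1 (dX2 A) = dX2 (dXi1 A)" "dXi2 (dX2 A) = dX2 (dXi2 A)" "dXi2 (dXi1 A) = dXi1 (dXi2 A)"
  by (rule symb_eqI; simp)+

section \<open>The filtration by weighted degree\<close>

definition deg_ge :: "nat \<Rightarrow> symb \<Rightarrow> bool" where
  "deg_ge m A \<longleftrightarrow> (\<forall>r a1 a2 b1 b2. 2 * r + a1 + a2 + b1 + b2 < m \<longrightarrow> coef A r a1 a2 b1 b2 = 0)"

lemma deg_geD: "deg_ge m A \<Longrightarrow> 2 * r + a1 + a2 + b1 + b2 < m \<Longrightarrow> coef A r a1 a2 b1 b2 = 0"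
  by (simp add: deg_ge_def)

lemma deg_ge_mono: "deg_ge m A \<Longrightarrow> n \<le> m \<Longrightarrow> deg_ge n A"
  by (simp add: deg_ge_def)

lemma deg_ge_trivial [simp]: "deg_ge 0 A" "deg_ge m 0"
  by (simp_all add: deg_ge_def)

lemma deg_ge_linear:
  "deg_ge m A \<Longrightarrow> deg_ge m B \<Longrightarrow> deg_ge m (A + B)"
  "deg_ge m A \<Longrightarrow> deg_ge m B \<Longrightarrow> deg_ge m (A - B)"
  "deg_ge m A \<Longrightarrow> deg_ge m (- A)"
  "deg_ge m A \<Longrightarrow> deg_ge m (scal c * A)"
  by (simp_all add: deg_ge_def)

lemma deg_ge_sum: "(\<And>i. i \<in> I \<Longrightarrow> deg_ge m (F i)) \<Longrightarrow> deg_ge m (sum F I)"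
  by (simp add: deg_ge_def)

lemma deg_ge_mult:
  assumes "deg_ge m A" "deg_ge n B"
  shows "deg_ge (m + n) (A * B)"
  unfolding deg_ge_def coef_mult
proof (intro allI impI sum.neutral ballI)
  fix r a1 a2 b1 b2 i j1 j2 k1 k2
  assume *: "2 * r + a1 + a2 + b1 + b2 < m + n" "i \<in> {0..r}" "j1 \<in> {0..a1}" "j2 \<in> {0..a2}"
    "k1 \<in> {0..b1}" "k2 \<in> {0..b2}"
  show "coef A i j1 j2 k1 k2 * coef B (r - i) (a1 - j1) (a2 - j2) (b1 - k1) (b2 - k2) = 0"
  proof (cases "2 * i + j1 + j2 + k1 + k2 < m")
    case True
    then show ?thesis using assms(1) by (simp add: deg_geD)
  next
    case False
    with * have "2 * (r - i) + (a1 - j1) + (a2 - j2) + (b1 - k1) + (b2 - k2) < n"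
      by auto
    then show ?thesis using assms(2) by (simp add: deg_geD)
  qed
qed

lemma deg_ge_generators: "deg_ge 1 X1" "deg_ge 1 X2" "deg_ge 1 Xi1" "deg_ge 1 Xi2"
  by (simp_all add: deg_ge_def coef_def X1_def X2_def Xi1_def Xi2_def)

lemma deg_ge_mult3: "deg_ge 1 A \<Longrightarrow> deg_ge 1 B \<Longrightarrow> deg_ge 1 C \<Longrightarrow> deg_ge 3 (A * B * C)"
  using deg_ge_mult[OF deg_ge_mult, of 1 A 1 B 1 C] by (simp add: numeral_3_eq_3)

text \<open>
  Truncated subtraction is harmless here: every symbol lies in the part of index zero.
\<close>

lemma deg_ge_d:
  assumes "deg_ge m A"
  shows "deg_ge (m - 1) (dX1 A)" "deg_ge (m - 1) (dX2 A)"
    "deg_ge (m - 1) (dXi1 A)" "deg_ge (m - 1) (dXi2 A)"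
  using assms by (auto simp: deg_ge_def)

lemma deg_ge_all_imp_0:
  assumes "\<And>m. deg_ge m A"
  shows "A = 0"
  by (rule symb_eqI) (use assms[THEN deg_geD, OF lessI] in simp)

text \<open>
  A formal sum agrees, up to high degree, with the finite sum of its members of low degree. The
  exponential and the expansions in \<open>z\<close>-monomials are handled through this comparison.
\<close>

lemma deg_ge_fsum:
  assumes "finite I" and "\<And>i. i \<notin> I \<Longrightarrow> deg_ge m (F i)"
  shows "deg_ge m (fsum F - sum F I)"
  unfolding deg_ge_def
proof (intro allI impI)
  fix r a1 a2 b1 b2
  assume *: "2 * r + a1 + a2 + b1 + b2 < m"
  have "(\<Sum>i | coef (F i) r a1 a2 b1 b2 \<noteq> 0. coef (F i) r a1 a2 b1 b2) =
        (\<Sum>i\<in>I. coef (F i) r a1 a2 b1 b2)"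
    by (intro sum.mono_neutral_left) (use assms(1) assms(2)[THEN deg_geD, OF _ *] in auto)
  then show "coef (fsum F - sum F I) r a1 a2 b1 b2 = 0"
    by (simp add: fsum_def)
qed

section \<open>The Moyal bracket\<close>

lemma bidiff_linear:
  "bidiff j (A + B) C = bidiff j A C + bidiff j B C"
  "bidiff j (A - B) C = bidiff j A C - bidiff j B C"
  "bidiff j (scal c * A) C = scal c * bidiff j A C"
  "bidiff j C (A + B) = bidiff j C A + bidiff j C B"
  "bidiff j C (A - B) = bidiff j C A - bidiff j C B"
  "bidiff j C (scal c * A) = scal c * bidiff j C A"
  by (induction j arbitrary: A B C) (simp_all add: ring_distribs)

lemma bidiff_0 [simp]: "bidiff j 0 A = 0" "bidiff j A 0 = 0"
  by (induction j arbitrary: A) simp_all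

text \<open>
  Exchanging the arguments changes the sign of the bidifferential operator, so only its odd powers
  survive in a commutator.
\<close>

lemma bidiff_swap: "bidiff j B A = (- 1) ^ j * bidiff j A B"
proof (induction j arbitrary: A B)
  case 0
  then show ?case by (simp add: mult.commute)
next
  case (Suc j)
  show ?case
    unfolding bidiff.simps Suc.IH[of "dX1 B" "dXi1 A"] Suc.IH[of "dX2 B" "dXi2 A"]
      Suc.IH[of "dXi1 B" "dX1 A"] Suc.IH[of "dXi2 B" "dX2 A"]
    by (simp add: algebra_simps)
qed

lemma deg_ge_bidiff:
  assumes "deg_ge m A" "deg_ge n B"
  shows "deg_ge (m + n - 2 * j) (bidiff j A B)"
  using assms
proof (induction j arbitrary: A B m n)
  case 0
  then show ?case by (simp add: deg_ge_mult)
next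
  case (Suc j)
  have *: "deg_ge (m + n - 2 * Suc j) (bidiff j A' B')"
    if "deg_ge (m - 1) A'" "deg_ge (n - 1) B'" for A' B'
    by (rule deg_ge_mono[OF Suc.IH[OF that]]) simp
  show ?case
    by (simp only: bidiff.simps) (intro deg_ge_linear * deg_ge_d Suc.prems)
qed

text \<open>
  The factor \<open>\<hbar>\<^sup>j\<close> makes the sum that defines the Moyal product finite in every order of \<open>\<hbar>\<close>.
\<close>

lemma coef_moyal:
  "coef (moyal A B) r a1 a2 b1 b2 =
     (\<Sum>j\<le>r. (\<i> / 2) ^ j / fact j * coef (bidiff j A B) (r - j) a1 a2 b1 b2)"
proof -
  let ?F = "\<lambda>j. scal ((\<i> / 2) ^ j / fact j) * hbar ^ j * bidiff j A B"
  have c: "coef (?F j) r a1 a2 b1 b2 =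
      (if r < j then 0 else (\<i> / 2) ^ j / fact j * coef (bidiff j A B) (r - j) a1 a2 b1 b2)" for j
    by (simp add: mult.assoc)
  have "coef (moyal A B) r a1 a2 b1 b2 = (\<Sum>j | coef (?F j) r a1 a2 b1 b2 \<noteq> 0. coef (?F j) r a1 a2 b1 b2)"
    by (simp add: moyal_def fsum_def)
  also have "\<dots> = (\<Sum>j\<le>r. coef (?F j) r a1 a2 b1 b2)"
    by (rule sum.mono_neutral_left) (auto simp: c split: if_splits)
  also have "\<dots> = (\<Sum>j\<le>r. (\<i> / 2) ^ j / fact j * coef (bidiff j A B) (r - j) a1 a2 b1 b2)"
    by (rule sum.cong) (auto simp: c)
  finally show ?thesis .
qed

lemma coef_ad:
  "coef (ad_over_hbar A B) r a1 a2 b1 b2 =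
     (\<Sum>j\<le>Suc r. \<i> * (\<i> / 2) ^ j / fact j *
        coef (bidiff j A B - bidiff j B A) (Suc r - j) a1 a2 b1 b2)"
  unfolding ad_over_hbar_def moyal_commutator_def
  by (simp only: coef_scal_mult coef_shift coef_diff coef_moyal Suc_eq_plus1)
    (simp only: sum_distrib_left right_diff_distrib sum_subtractf times_divide_eq_left
      times_divide_eq_right mult.assoc)

section \<open>Wirtinger derivatives and expansions in complex coordinates\<close>

text \<open>
  The derivatives with respect to \<open>z\<^sub>1\<close>, \<open>z\<^sub>2\<close> and to the conjugate variables.
\<close>

definition wz1 :: "symb \<Rightarrow> symb" where "wz1 A = scal (1 / 2) * (dX1 A - scal \<i> * dXi1 A)"
definition wz2 :: "symb \<Rightarrow> symb" where "wz2 A = scal (1 / 2) * (dX2 A - scal \<i> * dXi2 A)"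
definition wb1 :: "symb \<Rightarrow> symb" where "wb1 A = scal (1 / 2) * (dX1 A + scal \<i> * dXi1 A)"
definition wb2 :: "symb \<Rightarrow> symb" where "wb2 A = scal (1 / 2) * (dX2 A + scal \<i> * dXi2 A)"

lemmas wirtinger_defs = wz1_def wz2_def wb1_def wb2_def

lemma wirtinger_commute:
  "wz2 (wz1 A) = wz1 (wz2 A)" "wb1 (wz1 A) = wz1 (wb1 A)" "wb2 (wz1 A) = wz1 (wb2 A)"
  "wb1 (wz2 A) = wz2 (wb1 A)" "wb2 (wz2 A) = wz2 (wb2 A)" "wb2 (wb1 A) = wb1 (wb2 A)"
  by (rule symb_eqI; simp add: wirtinger_defs d_commute; simp add: field_simps)+

lemma wirtinger_linear:
  "wz1 (A + B) = wz1 A + wz1 B" "wz1 (A - B) = wz1 A - wz1 B" "wz1 (scal c * A) = scal c * wz1 A"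
  "wz2 (A + B) = wz2 A + wz2 B" "wz2 (A - B) = wz2 A - wz2 B" "wz2 (scal c * A) = scal c * wz2 A"
  "wb1 (A + B) = wb1 A + wb1 B" "wb1 (A - B) = wb1 A - wb1 B" "wb1 (scal c * A) = scal c * wb1 A"
  "wb2 (A + B) = wb2 A + wb2 B" "wb2 (A - B) = wb2 A - wb2 B" "wb2 (scal c * A) = scal c * wb2 A"
  by (rule symb_eqI; simp add: wirtinger_defs; simp add: field_simps)+

lemma d_eq_wirtinger:
  "dX1 A = wz1 A + wb1 A" "dX2 A = wz2 A + wb2 A"
  "dXi1 A = scal \<i> * (wz1 A - wb1 A)" "dXi2 A = scal \<i> * (wz2 A - wb2 A)"
  by (rule symb_eqI; simp add: wirtinger_defs; simp add: field_simps)+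

lemma wirtinger_mult:
  "wz1 (A * B) = wz1 A * B + A * wz1 B" "wz2 (A * B) = wz2 A * B + A * wz2 B"
  "wb1 (A * B) = wb1 A * B + A * wb1 B" "wb2 (A * B) = wb2 A * B + A * wb2 B"
  by (simp_all add: wirtinger_defs d_mult algebra_simps)

lemma deg_ge_wirtinger:
  assumes "deg_ge (Suc m) A"
  shows "deg_ge m (wz1 A)" "deg_ge m (wz2 A)" "deg_ge m (wb1 A)" "deg_ge m (wb2 A)"
  unfolding wirtinger_defs using assms[THEN deg_ge_d(1)] assms[THEN deg_ge_d(2)]
    assms[THEN deg_ge_d(3)] assms[THEN deg_ge_d(4)]
  by (auto intro!: deg_ge_linear)

text \<open>
  Taylor's formula in the coordinates \<open>z\<close>, \<open>z'\<close>: the coefficient of \<open>\<hbar>\<^sup>r z\<^sup>\<alpha> z'\<^sup>\<beta>\<close> is a normalized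
  mixed Wirtinger derivative at the origin. In contrast to the description by unique existence in
  \<open>zcoef\<close>, this form is visibly linear and interacts well with derivations.
\<close>

definition wcoef :: "symb \<Rightarrow> nat \<Rightarrow> nat \<times> nat \<Rightarrow> nat \<times> nat \<Rightarrow> complex" where
  "wcoef A r \<alpha> \<beta> =
     coef ((wz1 ^^ fst \<alpha>) ((wz2 ^^ snd \<alpha>) ((wb1 ^^ fst \<beta>) ((wb2 ^^ snd \<beta>) A)))) r 0 0 0 0
     / (fact (fst \<alpha>) * fact (snd \<alpha>) * fact (fst \<beta>) * fact (snd \<beta>))"

lemma funpow_commute:
  assumes "\<And>x. f (g x) = g (f x)"
  shows "(f ^^ n) (g x) = g ((f ^^ n) x)"
  by (induction n) (simp_all add: assms)

lemma wcoef_0: "wcoef A r (0, 0) (0, 0) = coef A r 0 0 0 0"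
  by (simp add: wcoef_def)

text \<open>
  The recursion through which all properties of the coefficients are proved: the Wirtinger derivatives
  commute, so any one of them can be applied first.
\<close>

lemma wcoef_Suc:
  "wcoef A r (Suc a1, a2) (b1, b2) = wcoef (wz1 A) r (a1, a2) (b1, b2) / of_nat (Suc a1)"
  "wcoef A r (a1, Suc a2) (b1, b2) = wcoef (wz2 A) r (a1, a2) (b1, b2) / of_nat (Suc a2)"
  "wcoef A r (a1, a2) (Suc b1, b2) = wcoef (wb1 A) r (a1, a2) (b1, b2) / of_nat (Suc b1)"
  "wcoef A r (a1, a2) (b1, Suc b2) = wcoef (wb2 A) r (a1, a2) (b1, b2) / of_nat (Suc b2)"
  by (simp_all add: wcoef_def funpow_Suc_right funpow_commute[of wz2 wz1, OF wirtinger_commute(1)]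
      funpow_commute[of wb1 wz1, OF wirtinger_commute(2)] funpow_commute[of wb2 wz1, OF wirtinger_commute(3)] funpow_commute[of wb1 wz2, OF wirtinger_commute(4)]
      funpow_commute[of wb2 wz2, OF wirtinger_commute(5)] funpow_commute[of wb2 wb1, OF wirtinger_commute(6)]
      del: funpow.simps(2) of_nat_Suc)

lemma multi_index_induct:
  fixes Q :: "nat \<times> nat \<Rightarrow> nat \<times> nat \<Rightarrow> bool"
  assumes zero: "Q (0, 0) (0, 0)"
    and "\<And>a1 a2 b1 b2. Q (a1, a2) (b1, b2) \<Longrightarrow> Q (Suc a1, a2) (b1, b2)"
    and "\<And>a1 a2 b1 b2. Q (a1, a2) (b1, b2) \<Longrightarrow> Q (a1, Suc a2) (b1, b2)"
    and "\<And>a1 a2 b1 b2. Q (a1, a2) (b1, b2) \<Longrightarrow> Q (a1, a2) (Suc b1, b2)"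
    and "\<And>a1 a2 b1 b2. Q (a1, a2) (b1, b2) \<Longrightarrow> Q (a1, a2) (b1, Suc b2)"
  shows "Q \<alpha> \<beta>"
proof -
  obtain a1 a2 where a: "\<alpha> = (a1, a2)" by (cases \<alpha>)
  obtain b1 b2 where b: "\<beta> = (b1, b2)" by (cases \<beta>)
  have 1: "Q (0, 0) (0, b2)" by (induction b2) (use assms in auto)
  have 2: "Q (0, 0) (b1, b2)" by (induction b1) (use assms 1 in auto)
  have 3: "Q (0, a2) (b1, b2)" by (induction a2) (use assms 2 in auto)
  have "Q (a1, a2) (b1, b2)" by (induction a1) (use assms 3 in auto)
  then show ?thesis by (simp add: a b)
qed

definition index_degree :: "nat \<times> nat \<Rightarrow> nat \<times> nat \<Rightarrow> nat" where
  "index_degree \<alpha> \<beta> = fst \<alpha> + snd \<alpha> + fst \<beta> + snd \<beta>"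

lemma wcoef_linear_aux:
  "\<forall>A B. wcoef (A + B) r \<alpha> \<beta> = wcoef A r \<alpha> \<beta> + wcoef B r \<alpha> \<beta> \<and> wcoef (A - B) r \<alpha> \<beta> = wcoef A r \<alpha> \<beta> - wcoef B r \<alpha> \<beta> \<and>
     wcoef (scal c * A) r \<alpha> \<beta> = c * wcoef A r \<alpha> \<beta>"
  by (induction \<alpha> \<beta> rule: multi_index_induct)
    (simp_all add: wcoef_0 wcoef_Suc wirtinger_linear add_divide_distrib diff_divide_distrib del: of_nat_Suc)

lemma wcoef_linear [simp]:
  "wcoef (A + B) r \<alpha> \<beta> = wcoef A r \<alpha> \<beta> + wcoef B r \<alpha> \<beta>"
  "wcoef (A - B) r \<alpha> \<beta> = wcoef A r \<alpha> \<beta> - wcoef B r \<alpha> \<beta>"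
  "wcoef (scal c * A) r \<alpha> \<beta> = c * wcoef A r \<alpha> \<beta>"
  using wcoef_linear_aux by blast+

lemma wcoef_zero [simp]: "wcoef 0 r \<alpha> \<beta> = 0"
  using wcoef_linear(2)[of 0 0] by simp

lemma wcoef_sum: "wcoef (sum F I) r \<alpha> \<beta> = (\<Sum>i\<in>I. wcoef (F i) r \<alpha> \<beta>)"
  by (induction I rule: infinite_finite_induct) simp_all

lemma wcoef_deg_ge:
  assumes "deg_ge m A" "2 * r + index_degree \<alpha> \<beta> < m"
  shows "wcoef A r \<alpha> \<beta> = 0"
proof -
  have "\<forall>A. deg_ge (Suc (2 * r + index_degree \<alpha> \<beta>)) A \<longrightarrow> wcoef A r \<alpha> \<beta> = 0"
    by (induction \<alpha> \<beta> rule: multi_index_induct)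
      (simp_all add: wcoef_0 wcoef_Suc index_degree_def deg_geD deg_ge_wirtinger del: of_nat_Suc)
  then show ?thesis using assms deg_ge_mono[of m A] by auto
qed

text \<open>
  The derivatives with respect to \<open>x\<close> and \<open>\<xi>\<close> are combinations of Wirtinger derivatives. Hence the
  symbols with vanishing \<open>z\<close>-coefficients are closed under them, and all their Taylor coefficients
  vanish. The induction lowers the degree bound \<open>m\<close> together with the order of the derivative.
\<close>

lemma coef_eq_0_if_wcoef_eq_0:
  assumes "\<And>r \<alpha> \<beta>. 2 * r + index_degree \<alpha> \<beta> < m \<Longrightarrow> wcoef A r \<alpha> \<beta> = 0"
    and "2 * r + a1 + a2 + b1 + b2 < m"
  shows "coef A r a1 a2 b1 b2 = 0"
  using assms
proof (induction "a1 + a2 + b1 + b2" arbitrary: A m a1 a2 b1 b2)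
  case 0
  from "0.prems"(1)[of r "(0,0)" "(0,0)"] 0 show ?case
    by (simp add: wcoef_0 index_degree_def)
next
  case (Suc n)
  have w: "wcoef (wz1 A) r \<alpha> \<beta> = 0 \<and> wcoef (wz2 A) r \<alpha> \<beta> = 0 \<and> wcoef (wb1 A) r \<alpha> \<beta> = 0 \<and> wcoef (wb2 A) r \<alpha> \<beta> = 0"
    if "2 * r + index_degree \<alpha> \<beta> < m - 1" for r \<alpha> \<beta>
    using Suc.prems(1)[of r "(Suc (fst \<alpha>), snd \<alpha>)" \<beta>] Suc.prems(1)[of r "(fst \<alpha>, Suc (snd \<alpha>))" \<beta>]
      Suc.prems(1)[of r \<alpha> "(Suc (fst \<beta>), snd \<beta>)"] Suc.prems(1)[of r \<alpha> "(fst \<beta>, Suc (snd \<beta>))"]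
      wcoef_Suc[of A r "fst \<alpha>" "snd \<alpha>" "fst \<beta>" "snd \<beta>"] that
    by (simp add: index_degree_def del: of_nat_Suc)
  consider a where "a1 = Suc a" | a where "a2 = Suc a" | b where "b1 = Suc b" | b where "b2 = Suc b"
    using Suc.hyps(2) by (metis add_is_0 nat.distinct(1) not0_implies_Suc)
  then show ?case
  proof cases
    case 1
    have "coef (dX1 A) r a a2 b1 b2 = 0"
      by (rule Suc.hyps(1)[of _ _ _ _ "m - 1"])
        (use Suc.hyps(2) Suc.prems(2) 1 w in \<open>auto simp: d_eq_wirtinger\<close>)
    then show ?thesis using 1 by (simp del: of_nat_Suc)
  next
    case 2
    have "coef (dX2 A) r a1 a b1 b2 = 0"
      by (rule Suc.hyps(1)[of _ _ _ _ "m - 1"])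
        (use Suc.hyps(2) Suc.prems(2) 2 w in \<open>auto simp: d_eq_wirtinger\<close>)
    then show ?thesis using 2 by (simp del: of_nat_Suc)
  next
    case 3
    have "coef (dXi1 A) r a1 a2 b b2 = 0"
      by (rule Suc.hyps(1)[of _ _ _ _ "m - 1"])
        (use Suc.hyps(2) Suc.prems(2) 3 w in \<open>auto simp: d_eq_wirtinger\<close>)
    then show ?thesis using 3 by (simp del: of_nat_Suc)
  next
    case 4
    have "coef (dXi2 A) r a1 a2 b1 b = 0"
      by (rule Suc.hyps(1)[of _ _ _ _ "m - 1"])
        (use Suc.hyps(2) Suc.prems(2) 4 w in \<open>auto simp: d_eq_wirtinger\<close>)
    then show ?thesis using 4 by (simp del: of_nat_Suc)
  qed
qed

text \<open>
  The change between \<open>(x, \<xi>)\<close> and \<open>(z, z')\<close> is linear and respects degrees.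
\<close>

lemma deg_ge_iff_wcoef:
  "deg_ge m A \<longleftrightarrow> (\<forall>r \<alpha> \<beta>. 2 * r + index_degree \<alpha> \<beta> < m \<longrightarrow> wcoef A r \<alpha> \<beta> = 0)"
  using wcoef_deg_ge coef_eq_0_if_wcoef_eq_0 unfolding deg_ge_def by metis

lemma symb_eqI_wcoef:
  assumes "\<And>r \<alpha> \<beta>. wcoef A r \<alpha> \<beta> = wcoef B r \<alpha> \<beta>"
  shows "A = B"
  using deg_ge_all_imp_0[of "A - B"] assms by (simp add: deg_ge_iff_wcoef)

lemma wirtinger_generators:
  "wz1 hbar = 0" "wz2 hbar = 0" "wb1 hbar = 0" "wb2 hbar = 0"
  "wz1 (X1 + scal \<i> * Xi1) = 1" "wz1 (X1 - scal \<i> * Xi1) = 0"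
  "wz1 (X2 + scal \<i> * Xi2) = 0" "wz1 (X2 - scal \<i> * Xi2) = 0"
  "wz2 (X2 + scal \<i> * Xi2) = 1" "wz2 (X2 - scal \<i> * Xi2) = 0"
  "wz2 (X1 + scal \<i> * Xi1) = 0" "wz2 (X1 - scal \<i> * Xi1) = 0"
  "wb1 (X1 + scal \<i> * Xi1) = 0" "wb1 (X1 - scal \<i> * Xi1) = 1"
  "wb1 (X2 + scal \<i> * Xi2) = 0" "wb1 (X2 - scal \<i> * Xi2) = 0"
  "wb2 (X2 + scal \<i> * Xi2) = 0" "wb2 (X2 - scal \<i> * Xi2) = 1"
  "wb2 (X1 + scal \<i> * Xi1) = 0" "wb2 (X1 - scal \<i> * Xi1) = 0"
  by (rule symb_eqI; simp add: wirtinger_defs coef_1 coef_scal)+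

lemma wirtinger_1 [simp]: "wz1 1 = 0" "wz2 1 = 0" "wb1 1 = 0" "wb2 1 = 0"
  by (simp_all add: wirtinger_defs)

lemma wirtinger_power:
  "wz1 (A ^ n) = of_nat n * A ^ (n - 1) * wz1 A"
  "wz2 (A ^ n) = of_nat n * A ^ (n - 1) * wz2 A"
  "wb1 (A ^ n) = of_nat n * A ^ (n - 1) * wb1 A"
  "wb2 (A ^ n) = of_nat n * A ^ (n - 1) * wb2 A"
proof -
  have *: "D (A ^ n) = of_nat n * A ^ (n - 1) * D A"
    if "\<And>A B :: symb. D (A * B) = D A * B + A * D B" "D 1 = 0" for D
  proof (induction n)
    case (Suc n)
    then show ?case by (cases n) (simp_all add: that algebra_simps)
  qed (simp add: that)
  show "wz1 (A ^ n) = of_nat n * A ^ (n - 1) * wz1 A"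
    "wz2 (A ^ n) = of_nat n * A ^ (n - 1) * wz2 A"
    "wb1 (A ^ n) = of_nat n * A ^ (n - 1) * wb1 A"
    "wb2 (A ^ n) = of_nat n * A ^ (n - 1) * wb2 A"
    by (rule *; simp add: wirtinger_mult)+
qed

lemma wirtinger_zmon:
  "wz1 (zmon r (a1, a2) (b1, b2)) = scal (of_nat a1) * zmon r (a1 - 1, a2) (b1, b2)"
  "wz2 (zmon r (a1, a2) (b1, b2)) = scal (of_nat a2) * zmon r (a1, a2 - 1) (b1, b2)"
  "wb1 (zmon r (a1, a2) (b1, b2)) = scal (of_nat b1) * zmon r (a1, a2) (b1 - 1, b2)"
  "wb2 (zmon r (a1, a2) (b1, b2)) = scal (of_nat b2) * zmon r (a1, a2) (b1, b2 - 1)"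
  by (simp_all add: zmon_def wirtinger_mult wirtinger_power wirtinger_generators of_nat_eq_scal)

lemma coef_origin_mult_const:
  "coef (A * fps_const B) r 0 0 0 0 = coef A r 0 0 0 0 * B $ 0 $ 0 $ 0 $ 0"
  by (simp add: coef_def)

lemma coef_zmon_origin:
  "coef (zmon r (a1, a2) (b1, b2)) s 0 0 0 0 =
     (if s = r \<and> a1 = 0 \<and> a2 = 0 \<and> b1 = 0 \<and> b2 = 0 then 1 else 0)"
  by (auto simp: zmon_def hbar_def X1_def X2_def Xi1_def Xi2_def scal_def coef_origin_mult_const
      fps_power_zeroth)
    (auto simp: coef_def power_0_left fps_X_power_nth fps_power_zeroth)

text \<open>
  A Wirtinger derivative sends a monomial to a multiple of a lower one, so repeated differentiation
  isolates each coefficient.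
\<close>

lemma wcoef_zmon: "wcoef (zmon r \<alpha> \<beta>) s \<alpha>' \<beta>' = (if r = s \<and> \<alpha> = \<alpha>' \<and> \<beta> = \<beta>' then 1 else 0)"
proof -
  have "\<forall>\<alpha> \<beta>. wcoef (zmon r \<alpha> \<beta>) s \<alpha>' \<beta>' = (if r = s \<and> \<alpha> = \<alpha>' \<and> \<beta> = \<beta>' then 1 else 0)"
    by (induction \<alpha>' \<beta>' rule: multi_index_induct)
      (auto simp: wcoef_0 wcoef_Suc wirtinger_zmon coef_zmon_origin simp del: of_nat_Suc)
  then show ?thesis by blast
qed

lemma finite_index_degree: "finite {(r, \<alpha>, \<beta>). 2 * r + index_degree \<alpha> \<beta> < m}"
  by (rule finite_subset[of _ "{..<m} \<times> ({..<m} \<times> {..<m}) \<times> ({..<m} \<times> {..<m})"])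
    (auto simp: index_degree_def)

lemma wcoef_zseries: "wcoef (zseries c) r \<alpha> \<beta> = c r \<alpha> \<beta>"
proof -
  let ?F = "\<lambda>(r, \<alpha>, \<beta>). scal (c r \<alpha> \<beta>) * zmon r \<alpha> \<beta>"
  let ?m = "Suc (2 * r + index_degree \<alpha> \<beta>)"
  let ?I = "{(r, \<alpha>, \<beta>). 2 * r + index_degree \<alpha> \<beta> < ?m}"
  have "deg_ge ?m (?F i)" if "i \<notin> ?I" for i
    using that by (cases i) (auto simp: deg_ge_iff_wcoef wcoef_zmon)
  then have "deg_ge ?m (zseries c - sum ?F ?I)"
    unfolding zseries_def by (intro deg_ge_fsum finite_index_degree)
  then have "wcoef (zseries c - sum ?F ?I) r \<alpha> \<beta> = 0"
    by (rule wcoef_deg_ge) simp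
  then have "wcoef (zseries c) r \<alpha> \<beta> = (\<Sum>i\<in>?I. wcoef (?F i) r \<alpha> \<beta>)"
    by (simp add: wcoef_sum)
  also have "\<dots> = (\<Sum>i\<in>?I. if i = (r, \<alpha>, \<beta>) then c r \<alpha> \<beta> else 0)"
    by (rule sum.cong) (auto simp: wcoef_zmon split: if_splits)
  also have "\<dots> = c r \<alpha> \<beta>"
    using finite_index_degree[of ?m] by (simp add: sum.delta')
  finally show ?thesis .
qed

text \<open>
  Existence and uniqueness of the expansion in \<open>z\<close>-monomials: the Wirtinger coefficients of a
  convergent sum of monomials are the given ones, and they determine the symbol.
\<close>

lemma zcoef_eq_wcoef: "zcoef A = wcoef A"
  unfolding zcoef_def
proof (rule the_equality)
  show "A = zseries (wcoef A)" by (rule symb_eqI_wcoef) (simp add: wcoef_zseries)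
  show "c = wcoef A" if "A = zseries c" for c
    by (simp add: that wcoef_zseries fun_eq_iff)
qed

lemma wcoef_res_proj: "wcoef (res_proj A) r \<alpha> \<beta> = (if \<alpha> = \<beta> then wcoef A r \<alpha> \<beta> else 0)"
  by (simp add: res_proj_def wcoef_zseries zcoef_eq_wcoef)

lemma wirtinger_hom_part:
  "wz1 (hom_part m A) = (if m = 0 then 0 else hom_part (m - 1) (wz1 A))"
  "wz2 (hom_part m A) = (if m = 0 then 0 else hom_part (m - 1) (wz2 A))"
  "wb1 (hom_part m A) = (if m = 0 then 0 else hom_part (m - 1) (wb1 A))"
  "wb2 (hom_part m A) = (if m = 0 then 0 else hom_part (m - 1) (wb2 A))"
  by (cases m; rule symb_eqI; simp add: hom_part_def wirtinger_defs)+

lemma coef_hom_part: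
  "coef (hom_part m A) r a1 a2 b1 b2 = (if 2 * r + a1 + a2 + b1 + b2 = m then coef A r a1 a2 b1 b2 else 0)"
  by (simp add: hom_part_def)

lemma wcoef_hom_part: "wcoef (hom_part m A) r \<alpha> \<beta> = (if 2 * r + index_degree \<alpha> \<beta> = m then wcoef A r \<alpha> \<beta> else 0)"
proof -
  have "\<forall>m A. wcoef (hom_part m A) r \<alpha> \<beta> = (if 2 * r + index_degree \<alpha> \<beta> = m then wcoef A r \<alpha> \<beta> else 0)"
    by (induction \<alpha> \<beta> rule: multi_index_induct)
      (auto simp: wcoef_0 wcoef_Suc wirtinger_hom_part index_degree_def coef_hom_part simp del: of_nat_Suc)
  then show ?thesis by blast
qed

section \<open>The Poisson bracket with the quadratic Hamiltonian\<close>

text \<open>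
  This is \<open>{A, H\<^sub>2}\<close>, the derivative of \<open>A\<close> along the flow of the two harmonic oscillators.
\<close>

definition H2_bracket :: "real \<Rightarrow> real \<Rightarrow> symb \<Rightarrow> symb" where
  "H2_bracket v1 v2 A = scal (of_real v1) * (Xi1 * dX1 A - X1 * dXi1 A)
     + scal (of_real v2) * (Xi2 * dX2 A - X2 * dXi2 A)"

lemma H2_bracket_linear:
  "H2_bracket v1 v2 (A + B) = H2_bracket v1 v2 A + H2_bracket v1 v2 B" "H2_bracket v1 v2 (A - B) = H2_bracket v1 v2 A - H2_bracket v1 v2 B"
  "H2_bracket v1 v2 (scal c * A) = scal c * H2_bracket v1 v2 A"
  by (rule symb_eqI; simp add: H2_bracket_def; simp add: algebra_simps)+

lemma d_H2_bracket:
  "dX1 (H2_bracket v1 v2 A) = H2_bracket v1 v2 (dX1 A) - scal (of_real v1) * dXi1 A"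
  "dX2 (H2_bracket v1 v2 A) = H2_bracket v1 v2 (dX2 A) - scal (of_real v2) * dXi2 A"
  "dXi1 (H2_bracket v1 v2 A) = H2_bracket v1 v2 (dXi1 A) + scal (of_real v1) * dX1 A"
  "dXi2 (H2_bracket v1 v2 A) = H2_bracket v1 v2 (dXi2 A) + scal (of_real v2) * dX2 A"
  by (simp_all add: H2_bracket_def d_mult d_commute algebra_simps)

lemma wirtinger_H2_bracket:
  "wz1 (H2_bracket v1 v2 A) = H2_bracket v1 v2 (wz1 A) - scal (\<i> * of_real v1) * wz1 A"
  "wz2 (H2_bracket v1 v2 A) = H2_bracket v1 v2 (wz2 A) - scal (\<i> * of_real v2) * wz2 A"
  "wb1 (H2_bracket v1 v2 A) = H2_bracket v1 v2 (wb1 A) + scal (\<i> * of_real v1) * wb1 A"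
  "wb2 (H2_bracket v1 v2 A) = H2_bracket v1 v2 (wb2 A) + scal (\<i> * of_real v2) * wb2 A"
  unfolding wirtinger_defs d_H2_bracket H2_bracket_linear by (rule symb_eqI; simp; simp add: algebra_simps)+

text \<open>
  The eigenvalue of \<open>{_, H\<^sub>2}\<close> on \<open>\<hbar>\<^sup>r z\<^sup>\<alpha> z'\<^sup>\<beta>\<close>; it vanishes for \<open>\<alpha> = \<beta>\<close>.
\<close>

definition H2_eigenvalue :: "real \<Rightarrow> real \<Rightarrow> nat \<times> nat \<Rightarrow> nat \<times> nat \<Rightarrow> complex" where
  "H2_eigenvalue v1 v2 \<alpha> \<beta> = \<i> * (of_real v1 * (of_nat (fst \<beta>) - of_nat (fst \<alpha>))
     + of_real v2 * (of_nat (snd \<beta>) - of_nat (snd \<alpha>)))"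

text \<open>
  The commutators of \<open>{_, H\<^sub>2}\<close> with the Wirtinger derivatives are multiples of these derivatives, and
  at the origin the bracket vanishes because the Hamiltonian vector field does.
\<close>

lemma wcoef_H2_bracket: "wcoef (H2_bracket v1 v2 A) r \<alpha> \<beta> = H2_eigenvalue v1 v2 \<alpha> \<beta> * wcoef A r \<alpha> \<beta>"
proof -
  have "\<forall>A. wcoef (H2_bracket v1 v2 A) r \<alpha> \<beta> = H2_eigenvalue v1 v2 \<alpha> \<beta> * wcoef A r \<alpha> \<beta>"
  proof (induction \<alpha> \<beta> rule: multi_index_induct)
    case 1
    then show ?case by (simp add: wcoef_0 H2_eigenvalue_def H2_bracket_def)
  qed (simp_all add: wcoef_Suc wirtinger_H2_bracket, (simp_all add: H2_eigenvalue_def algebra_simps add_divide_distrib diff_divide_distrib)?)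
  then show ?thesis by blast
qed

section \<open>The adjoint operator and the filtration\<close>

lemma ad_linear:
  "ad_over_hbar (A + B) C = ad_over_hbar A C + ad_over_hbar B C"
  "ad_over_hbar (A - B) C = ad_over_hbar A C - ad_over_hbar B C"
  "ad_over_hbar C (A + B) = ad_over_hbar C A + ad_over_hbar C B"
  "ad_over_hbar C (A - B) = ad_over_hbar C A - ad_over_hbar C B"
  "ad_over_hbar C (scal c * A) = scal c * ad_over_hbar C A"
  by (rule symb_eqI; simp add: coef_ad bidiff_linear;
      simp add: algebra_simps add_divide_distrib diff_divide_distrib sum.distrib sum_subtractf
        sum_distrib_left)+

lemma ad_swap: "ad_over_hbar B A = - ad_over_hbar A B"
  by (rule symb_eqI) (simp add: ad_over_hbar_def moyal_commutator_def algebra_simps)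

lemma ad_zero [simp]: "ad_over_hbar A 0 = 0" "ad_over_hbar 0 A = 0"
  using ad_linear(4)[of A 0 0] ad_linear(2)[of 0 0 A] by simp_all

lemma ad_minus: "ad_over_hbar A (- B) = - ad_over_hbar A B" "ad_over_hbar (- A) B = - ad_over_hbar A B"
  using ad_linear(4)[of A 0 B] ad_linear(2)[of 0 A B] by simp_all

text \<open>
  Each application of the bidifferential operator costs two degrees, which the accompanying factor
  \<open>\<hbar>\<close> restores; the final division by \<open>\<hbar>\<close> accounts for the loss of two.
\<close>

lemma deg_ge_ad:
  assumes "deg_ge m A" "deg_ge n B"
  shows "deg_ge (m + n - 2) (ad_over_hbar A B)"
  unfolding deg_ge_def coef_ad
proof (intro allI impI sum.neutral ballI)
  fix r a1 a2 b1 b2 j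
  assume *: "2 * r + a1 + a2 + b1 + b2 < m + n - 2" "j \<in> {..Suc r}"
  have "deg_ge (m + n - 2 * j) (bidiff j A B)" "deg_ge (m + n - 2 * j) (bidiff j B A)"
    using deg_ge_bidiff[of m A n B j] deg_ge_bidiff[of n B m A j] assms by (simp_all add: add.commute)
  then have "deg_ge (m + n - 2 * j) (bidiff j A B - bidiff j B A)"
    by (rule deg_ge_linear)
  moreover have "2 * (Suc r - j) + a1 + a2 + b1 + b2 < m + n - 2 * j"
    using * by auto
  ultimately have "coef (bidiff j A B - bidiff j B A) (Suc r - j) a1 a2 b1 b2 = 0"
    by (rule deg_geD)
  then show "\<i> * (\<i> / 2) ^ j / fact j *
        coef (bidiff j A B - bidiff j B A) (Suc r - j) a1 a2 b1 b2 = 0"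
    by simp
qed

text \<open>
  The bracket \<open>{_, H\<^sub>2}\<close> acts on every order in \<open>\<hbar>\<close> separately and is linear, so it may be applied
  under the finite sum that gives an order of a Moyal bracket.
\<close>

lemma coef_H2_bracket_sum:
  assumes "\<And>a1 a2 b1 b2. coef A r a1 a2 b1 b2 = (\<Sum>j\<in>J. k j * coef (B j) (s j) a1 a2 b1 b2)"
  shows "coef (H2_bracket v1 v2 A) r a1 a2 b1 b2 = (\<Sum>j\<in>J. k j * coef (H2_bracket v1 v2 (B j)) (s j) a1 a2 b1 b2)"
  by (simp add: H2_bracket_def assms; simp add: algebra_simps sum.distrib sum_subtractf sum_distrib_left
      sum_negf)

lemma H2_bracket_mult: "H2_bracket v1 v2 (A * B) = H2_bracket v1 v2 A * B + A * H2_bracket v1 v2 B"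
  by (simp add: H2_bracket_def d_mult algebra_simps)

text \<open>
  The flow of \<open>H\<^sub>2\<close> is linear and symplectic, hence leaves the bidifferential operator invariant; this
  is the infinitesimal version.
\<close>

lemma H2_bracket_bidiff: "H2_bracket v1 v2 (bidiff j A B) = bidiff j (H2_bracket v1 v2 A) B + bidiff j A (H2_bracket v1 v2 B)"
proof (induction j arbitrary: A B)
  case 0
  then show ?case by (simp add: H2_bracket_mult)
next
  case (Suc j)
  show ?case
    unfolding bidiff.simps d_H2_bracket H2_bracket_linear Suc.IH bidiff_linear by (simp add: algebra_simps)
qed

text \<open>
  The special case of the Jacobi identity that the comparison of two normal forms needs. It follows
  from the invariance of the bidifferential operator, without associativity of the Moyal product.
\<close>

lemma H2_bracket_ad: "H2_bracket v1 v2 (ad_over_hbar A B) = ad_over_hbar (H2_bracket v1 v2 A) B + ad_over_hbar A (H2_bracket v1 v2 B)"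
proof (rule symb_eqI)
  fix r a1 a2 b1 b2
  show "coef (H2_bracket v1 v2 (ad_over_hbar A B)) r a1 a2 b1 b2 =
      coef (ad_over_hbar (H2_bracket v1 v2 A) B + ad_over_hbar A (H2_bracket v1 v2 B)) r a1 a2 b1 b2"
    unfolding coef_H2_bracket_sum[OF coef_ad] H2_bracket_linear H2_bracket_bidiff coef_add coef_diff coef_ad
    by (simp add: algebra_simps flip: sum.distrib)
qed

lemma d_H2:
  "dX1 (H2 v1 v2) = scal (of_real v1) * X1" "dX2 (H2 v1 v2) = scal (of_real v2) * X2"
  "dXi1 (H2 v1 v2) = scal (of_real v1) * Xi1" "dXi2 (H2 v1 v2) = scal (of_real v2) * Xi2"
  by (rule symb_eqI; simp add: H2_def power2_eq_square d_mult; simp add: field_simps)+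

lemma bidiff_H2:
  "bidiff (Suc 0) A (H2 v1 v2) = H2_bracket v1 v2 A"
  "bidiff (Suc (Suc (Suc j))) A (H2 v1 v2) = 0"
  subgoal by (simp add: d_H2 H2_bracket_def algebra_simps)
  subgoal by (simp add: d_H2)
  done

text \<open>
  For a quadratic second argument the Moyal bracket is the Poisson bracket: the third and higher powers
  of the bidifferential operator differentiate the quadratic symbol more than twice, and the even
  ones cancel in the commutator.
\<close>

lemma ad_H2: "ad_over_hbar A (H2 v1 v2) = - H2_bracket v1 v2 A"
proof (rule symb_eqI)
  fix r a1 a2 b1 b2
  let ?f = "\<lambda>j. \<i> * (\<i> / 2) ^ j / fact j *
     coef (bidiff j A (H2 v1 v2) - bidiff j (H2 v1 v2) A) (Suc r - j) a1 a2 b1 b2"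
  have "?f j = (if j = 1 then - coef (H2_bracket v1 v2 A) r a1 a2 b1 b2 else 0)" for j
  proof -
    consider "j = 0" | "j = 1" | "j = 2" | i where "j = Suc (Suc (Suc i))"
      by (metis One_nat_def not0_implies_Suc numeral_2_eq_2)
    then show ?thesis
    proof cases
      case 2
      then show ?thesis
        using bidiff_swap[of "Suc 0" "H2 v1 v2" A] by (simp add: bidiff_H2 del: bidiff.simps)
    next
      case 3
      then show ?thesis
        using bidiff_swap[of 2 "H2 v1 v2" A] by simp
    next
      case 4
      then show ?thesis
        using bidiff_swap[of j "H2 v1 v2" A] by (simp add: bidiff_H2 del: bidiff.simps)
    qed (simp add: mult.commute)
  qed
  then show "coef (ad_over_hbar A (H2 v1 v2)) r a1 a2 b1 b2 = coef (- H2_bracket v1 v2 A) r a1 a2 b1 b2"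
    unfolding coef_ad by (simp add: sum.delta)
qed

lemma deg_ge_H2_bracket:
  assumes "deg_ge m A"
  shows "deg_ge m (H2_bracket v1 v2 A)"
  using assms by (simp add: deg_ge_iff_wcoef wcoef_H2_bracket)

section \<open>Expansion of the exponential\<close>

lemma deg_ge_ad_pow:
  assumes "deg_ge 3 S" "deg_ge a A"
  shows "deg_ge (a + n) ((ad_over_hbar S ^^ n) A)"
proof (induction n)
  case (Suc n)
  then show ?case using deg_ge_ad[OF assms(1) Suc.IH] by (simp add: eval_nat_numeral)
qed (use assms in simp)

lemma exp_ad_approx:
  assumes "deg_ge 3 S"
  shows "deg_ge N (exp_ad S A - (\<Sum>n<N. scal (1 / fact n) * (ad_over_hbar S ^^ n) A))"
  unfolding exp_ad_def
proof (rule deg_ge_fsum)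
  fix n assume "n \<notin> {..<N}"
  then show "deg_ge N (scal (1 / fact n) * (ad_over_hbar S ^^ n) A)"
    using deg_ge_mono[OF deg_ge_ad_pow[OF assms deg_ge_trivial(1), of n A], of N]
    by (intro deg_ge_linear) simp
qed simp

text \<open>
  Two exponentials are compared through the brackets of low order once the differences of all
  brackets of order at least \<open>N\<close> are negligible.
\<close>

lemma exp_ad_diff_approx:
  assumes S: "deg_ge 3 S" "deg_ge 3 S'"
    and D: "\<And>n. n \<ge> N \<Longrightarrow> deg_ge k ((ad_over_hbar S ^^ n) A - (ad_over_hbar S' ^^ n) A')"
  shows "deg_ge k (exp_ad S A - exp_ad S' A' -
     (\<Sum>n<N. scal (1 / fact n) * ((ad_over_hbar S ^^ n) A - (ad_over_hbar S' ^^ n) A')))"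
proof -
  \<comment> \<open>Both exponentials are given by \<open>M\<close> terms up to degree \<open>k\<close>.\<close>
  define M where "M = max k N"
  let ?T = "\<lambda>n. scal (1 / fact n) * (ad_over_hbar S ^^ n) A"
  let ?T' = "\<lambda>n. scal (1 / fact n) * (ad_over_hbar S' ^^ n) A'"
  have TT': "deg_ge k (exp_ad S A - sum ?T {..<M})" "deg_ge k (exp_ad S' A' - sum ?T' {..<M})"
    by (rule deg_ge_mono[OF exp_ad_approx]; simp add: S M_def)+
  have tail: "deg_ge k (\<Sum>n\<in>{N..<M}. ?T n - ?T' n)"
    using D by (intro deg_ge_sum) (auto simp flip: right_diff_distrib intro: deg_ge_linear)
  have "(\<Sum>n<M. ?T n - ?T' n) = (\<Sum>n<N. ?T n - ?T' n) + (\<Sum>n\<in>{N..<M}. ?T n - ?T' n)"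
    by (subst sum.union_disjoint[symmetric]) (auto simp: M_def intro: sum.cong)
  then have "exp_ad S A - exp_ad S' A' -
      (\<Sum>n<N. scal (1 / fact n) * ((ad_over_hbar S ^^ n) A - (ad_over_hbar S' ^^ n) A')) =
      (exp_ad S A - sum ?T {..<M}) - (exp_ad S' A' - sum ?T' {..<M}) + (\<Sum>n\<in>{N..<M}. ?T n - ?T' n)"
    by (simp only: sum_subtractf right_diff_distrib) (simp add: algebra_simps)
  then show ?thesis
    using TT' tail by (simp only: deg_ge_linear)
qed

context
  fixes S S' A A' :: symb and m :: nat
  assumes S: "deg_ge 3 S" "deg_ge 3 S'" and A': "deg_ge 2 A'" and m: "m \<ge> 3"
    and diff: "deg_ge m (S - S')" "deg_ge m (A - A')"
begin

text \<open>
  The telescoping step for differences of iterated brackets.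
\<close>

lemma ad_diff:
  "ad_over_hbar S X - ad_over_hbar S' X' = ad_over_hbar S (X - X') + ad_over_hbar (S - S') X'"
  by (simp add: ad_linear)

text \<open>
  By telescoping, a difference of iterated brackets is a sum of brackets with one factor of degree
  at least \<open>m\<close>, and each additional bracket with \<open>S\<close> or \<open>S'\<close> raises the degree by one.
\<close>

lemma deg_ge_ad_pow_diff:
  "deg_ge (m + n) ((ad_over_hbar S ^^ Suc n) A - (ad_over_hbar S' ^^ Suc n) A')"
proof (induction n)
  case 0
  have "deg_ge m (ad_over_hbar S (A - A'))"
    using deg_ge_ad[OF S(1) diff(2)] by (rule deg_ge_mono) simp
  moreover have "deg_ge m (ad_over_hbar (S - S') A')"
    using deg_ge_ad[OF diff(1) A'] by simp
  ultimately show ?case by (simp add: ad_diff deg_ge_linear)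
next
  case (Suc n)
  have "deg_ge (m + Suc n) (ad_over_hbar S ((ad_over_hbar S ^^ Suc n) A - (ad_over_hbar S' ^^ Suc n) A'))"
    using deg_ge_ad[OF S(1) Suc.IH] by (rule deg_ge_mono) simp
  moreover have "deg_ge (m + Suc n) (ad_over_hbar (S - S') ((ad_over_hbar S' ^^ Suc n) A'))"
    using deg_ge_ad[OF diff(1) deg_ge_ad_pow[OF S(2) A']] by (rule deg_ge_mono) simp
  ultimately show ?case
    unfolding funpow.simps(2)[of "Suc n"] o_apply ad_diff by (rule deg_ge_linear)
qed

lemma exp_ad_diff_first_order:
  "deg_ge (Suc m) (exp_ad S A - exp_ad S' A' - (A - A' + ad_over_hbar (S - S') A'))"
proof -
  have "deg_ge (Suc m) (exp_ad S A - exp_ad S' A' -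
     (\<Sum>n<2. scal (1 / fact n) * ((ad_over_hbar S ^^ n) A - (ad_over_hbar S' ^^ n) A')))"
  proof (rule exp_ad_diff_approx[OF S])
    fix n :: nat assume "n \<ge> 2"
    then show "deg_ge (Suc m) ((ad_over_hbar S ^^ n) A - (ad_over_hbar S' ^^ n) A')"
      using deg_ge_mono[OF deg_ge_ad_pow_diff[of "n - 1"], of "Suc m"] by simp
  qed
  moreover have "deg_ge (Suc m) (ad_over_hbar S (A - A'))"
    using deg_ge_ad[OF S(1) diff(2)] by (rule deg_ge_mono) simp
  ultimately show ?thesis
    unfolding deg_ge_def by (simp add: eval_nat_numeral ad_diff)
qed

lemma exp_ad_diff_second_order:
  "deg_ge (Suc (Suc m)) (exp_ad S A - exp_ad S' A' -
     (A - A' + (ad_over_hbar S (A - A') + ad_over_hbar (S - S') A') +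
      scal (1 / 2) * (ad_over_hbar S (ad_over_hbar (S - S') A') +
        ad_over_hbar (S - S') (ad_over_hbar S' A'))))"
proof -
  have "deg_ge (Suc (Suc m)) (exp_ad S A - exp_ad S' A' -
     (\<Sum>n<3. scal (1 / fact n) * ((ad_over_hbar S ^^ n) A - (ad_over_hbar S' ^^ n) A')))"
  proof (rule exp_ad_diff_approx[OF S])
    fix n :: nat assume "n \<ge> 3"
    then show "deg_ge (Suc (Suc m)) ((ad_over_hbar S ^^ n) A - (ad_over_hbar S' ^^ n) A')"
      using deg_ge_mono[OF deg_ge_ad_pow_diff[of "n - 1"], of "Suc (Suc m)"] by simp
  qed
  moreover have "deg_ge (Suc (Suc m)) (ad_over_hbar S (ad_over_hbar S (A - A')))"
    using deg_ge_ad[OF S(1) deg_ge_ad[OF S(1) diff(2)]] by (rule deg_ge_mono) simp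
  moreover have "(\<Sum>n<3. scal (1 / fact n) * ((ad_over_hbar S ^^ n) A - (ad_over_hbar S' ^^ n) A')) =
     A - A' + (ad_over_hbar S (A - A') + ad_over_hbar (S - S') A') +
     scal (1 / 2) * (ad_over_hbar S (ad_over_hbar S (A - A')) +
       ad_over_hbar S (ad_over_hbar (S - S') A') + ad_over_hbar (S - S') (ad_over_hbar S' A'))"
    by (simp add: numeral_3_eq_3 ad_diff ad_linear(3))
  ultimately show ?thesis
    unfolding deg_ge_def by (simp add: distrib_left)
qed

end

section \<open>Existence and uniqueness of the generator\<close>

text \<open>
  Homogeneous parts and the resonant projection both act on each \<open>z\<close>-coefficient separately, so the
  conditions can be tested on coefficients.
\<close>

lemma qbnf_generator_iff:
  "qbnf_generator H S \<longleftrightarrow> deg_ge 3 S \<and> (\<forall>r \<alpha>. wcoef S r \<alpha> \<alpha> = 0) \<and>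
     (\<forall>r \<alpha> \<beta>. \<alpha> \<noteq> \<beta> \<longrightarrow> wcoef (exp_ad S H) r \<alpha> \<beta> = 0)"
proof -
  have eq_iff: "A = B \<longleftrightarrow> (\<forall>r \<alpha> \<beta>. wcoef A r \<alpha> \<beta> = wcoef B r \<alpha> \<beta>)" for A B
    using symb_eqI_wcoef by blast
  have "(\<forall>m<3. hom_part m S = 0) \<longleftrightarrow> deg_ge 3 S"
    by (auto simp: eq_iff wcoef_hom_part deg_ge_iff_wcoef)
  moreover have "(\<forall>m\<ge>3. res_proj (hom_part m S) = 0) \<longleftrightarrow> (\<forall>r \<alpha>. wcoef S r \<alpha> \<alpha> = 0)" if "deg_ge 3 S"
  proof -
    have "wcoef S r \<alpha> \<alpha> = 0" if "2 * r + index_degree \<alpha> \<alpha> < 3" for r \<alpha>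
      using wcoef_deg_ge[OF \<open>deg_ge 3 S\<close> that] .
    moreover have "(\<forall>m\<ge>3. res_proj (hom_part m S) = 0) \<longleftrightarrow>
        (\<forall>m\<ge>3. \<forall>r \<alpha>. 2 * r + index_degree \<alpha> \<alpha> = m \<longrightarrow> wcoef S r \<alpha> \<alpha> = 0)"
      by (auto simp: eq_iff wcoef_hom_part wcoef_res_proj)
    ultimately show ?thesis by (metis not_less)
  qed
  moreover have "res_proj (exp_ad S H) = exp_ad S H \<longleftrightarrow>
      (\<forall>r \<alpha> \<beta>. \<alpha> \<noteq> \<beta> \<longrightarrow> wcoef (exp_ad S H) r \<alpha> \<beta> = 0)"
    by (auto simp: eq_iff wcoef_res_proj)
  ultimately show ?thesis unfolding qbnf_generator_def by argo
qed

lemma H2_bracket_H2: "H2_bracket v1 v2 (H2 v1 v2) = 0"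
  by (simp add: H2_bracket_def d_H2 algebra_simps)

lemma H2_bracket_0: "H2_bracket v1 v2 0 = 0"
  by (simp add: H2_bracket_def)

lemma deg_ge_H2: "deg_ge 2 (H2 v1 v2)"
proof -
  have square: "deg_ge 2 (A * A)" if "deg_ge 1 A" for A
    using deg_ge_mult[OF that that] by (simp add: numeral_2_eq_2)
  show ?thesis
    unfolding H2_def power2_eq_square by (intro deg_ge_linear square deg_ge_generators)
qed

lemma exp_ad_0: "exp_ad 0 A = A"
proof -
  have pow: "(ad_over_hbar 0 ^^ n) A = (if n = 0 then A else 0)" for n
    by (induction n) simp_all
  have "exp_ad 0 A - A = 0"
  proof (rule deg_ge_all_imp_0)
    fix m
    have "deg_ge (Suc m) (exp_ad 0 A - (\<Sum>n<Suc m. scal (1 / fact n) * (ad_over_hbar 0 ^^ n) A))"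
      by (rule exp_ad_approx) simp
    moreover have "(\<Sum>n<Suc m. scal (1 / fact n) * (ad_over_hbar 0 ^^ n) A) = A"
      by (subst sum.lessThan_Suc_shift) (simp add: pow)
    ultimately show "deg_ge m (exp_ad 0 A - A)"
      using deg_ge_mono by fastforce
  qed
  then show ?thesis by simp
qed

text \<open>
  The hypothesis on the frequencies in the form in which it is used: the homological equation
  \<open>{S, H\<^sub>2} = A\<close> can be solved off the resonances.
\<close>

locale nonresonant =
  fixes v1 v2 :: real
  assumes H2_eigenvalue_eq_0: "H2_eigenvalue v1 v2 \<alpha> \<beta> = 0 \<Longrightarrow> \<alpha> = \<beta>"
begin

abbreviation "H U \<equiv> H2 v1 v2 + U"
abbreviation "H2_bracket' \<equiv> H2_bracket v1 v2"

lemma deg_ge_H: "deg_ge 3 U \<Longrightarrow> deg_ge 2 (H U)"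
  by (intro deg_ge_linear deg_ge_H2) (rule deg_ge_mono, auto)

lemma wcoef_H2_nonresonant: "\<alpha> \<noteq> \<beta> \<Longrightarrow> wcoef (H2 v1 v2) r \<alpha> \<beta> = 0"
  using wcoef_H2_bracket[of v1 v2 "H2 v1 v2" r \<alpha> \<beta>] H2_eigenvalue_eq_0[of \<alpha> \<beta>] by (auto simp: H2_bracket_H2)

text \<open>
  The leading term of the difference of two normal forms. The exponentials may belong to arbitrary
  \<open>S\<close>, \<open>S'\<close>, so the lemma serves the construction of a generator as well as the comparison of two.
\<close>

lemma first_order:
  assumes "deg_ge 3 S" "deg_ge 3 S'" "deg_ge 3 U'" "m \<ge> 3"
    and "deg_ge m (S - S')" "deg_ge m (U - U')"
  shows "deg_ge (Suc m) (exp_ad S (H U) - exp_ad S' (H U') - (U - U' - H2_bracket' (S - S')))"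
proof -
  have "deg_ge (Suc m) (exp_ad S (H U) - exp_ad S' (H U') -
      (H U - H U' + ad_over_hbar (S - S') (H U')))"
    by (rule exp_ad_diff_first_order) (use assms deg_ge_H in auto)
  moreover have "deg_ge (Suc m) (ad_over_hbar (S - S') U')"
    using deg_ge_ad[OF assms(5) assms(3)] by simp
  ultimately have "deg_ge (Suc m) (exp_ad S (H U) - exp_ad S' (H U') -
      (H U - H U' + ad_over_hbar (S - S') (H U')) + ad_over_hbar (S - S') U')"
    by (rule deg_ge_linear)
  then show ?thesis by (simp add: ad_linear(3) ad_H2 algebra_simps)
qed

text \<open>
  Induction on the degree up to \<open>m\<close>. If the generators agree below degree \<open>k\<close>, the difference of the
  normal forms is \<open>- {S - S', H\<^sub>2}\<close> in degree \<open>k\<close>. It has no nonresonant part, so by nonresonance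
  neither has \<open>S - S'\<close>; a resonant part is excluded by the normalization of generators.
\<close>

lemma generators_agree:
  assumes "deg_ge 3 U" "deg_ge 3 U'" "qbnf_generator (H U) S" "qbnf_generator (H U') S'"
    and "deg_ge m (U - U')"
  shows "deg_ge m (S - S')"
proof -
  note gen = assms(3,4)[unfolded qbnf_generator_iff]
  have S3: "deg_ge 3 (S - S')" using gen by (intro deg_ge_linear) simp_all
  have "deg_ge k (S - S')" if "3 \<le> k" "k \<le> m" for k
    using that
  proof (induction k rule: dec_induct)
    case (step k)
    have *: "deg_ge k (S - S')" by (rule step.IH) (use step.prems in simp)
    have "deg_ge (Suc k) (exp_ad S (H U) - exp_ad S' (H U') - (U - U' - H2_bracket' (S - S')))"
    proof (rule first_order)
      show "deg_ge k (U - U')" using assms(5) by (rule deg_ge_mono) (use step in simp)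
    qed (use gen assms(2) step.hyps * in blast)+
    moreover have "deg_ge (Suc k) (U - U')" using assms(5) step.prems by (rule deg_ge_mono)
    ultimately have "deg_ge (Suc k) (exp_ad S (H U) - exp_ad S' (H U') -
        (U - U' - H2_bracket' (S - S')) + (U - U'))"
      by (rule deg_ge_linear)
    then have "deg_ge (Suc k) (exp_ad S (H U) - exp_ad S' (H U') + H2_bracket' (S - S'))"
      by (simp add: algebra_simps)
    then have z: "wcoef (exp_ad S (H U)) r \<alpha> \<beta> - wcoef (exp_ad S' (H U')) r \<alpha> \<beta> +
        H2_eigenvalue v1 v2 \<alpha> \<beta> * wcoef (S - S') r \<alpha> \<beta> = 0" if "2 * r + index_degree \<alpha> \<beta> < Suc k" for r \<alpha> \<beta>
      using wcoef_deg_ge[OF _ that] by (fastforce simp: wcoef_H2_bracket)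
    show ?case
      unfolding deg_ge_iff_wcoef
    proof (intro allI impI)
      fix r \<alpha> \<beta> assume "2 * r + index_degree \<alpha> \<beta> < Suc k"
      note z = z[OF this]
      show "wcoef (S - S') r \<alpha> \<beta> = 0"
      proof (cases "\<alpha> = \<beta>")
        case True
        have "wcoef S r \<beta> \<beta> = 0" "wcoef S' r \<beta> \<beta> = 0" using gen by blast+
        then show ?thesis using True by simp
      next
        case False
        have "wcoef (exp_ad S (H U)) r \<alpha> \<beta> = 0" "wcoef (exp_ad S' (H U')) r \<alpha> \<beta> = 0"
          using gen False by blast+
        with z have "H2_eigenvalue v1 v2 \<alpha> \<beta> * wcoef (S - S') r \<alpha> \<beta> = 0" by simp
        then show ?thesis using H2_eigenvalue_eq_0[of \<alpha> \<beta>] False by (metis mult_eq_0_iff)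
      qed
    qed
  qed (use S3 in simp)
  then show ?thesis using S3 by (cases "3 \<le> m") (auto intro: deg_ge_mono)
qed

text \<open>
  The solution of the homological equation that removes the nonresonant terms of degree \<open>m\<close> that \<open>S\<close> has
  left in the exponential.
\<close>

definition correction :: "symb \<Rightarrow> nat \<Rightarrow> symb \<Rightarrow> symb" where
  "correction U m S = zseries (\<lambda>r \<alpha> \<beta>.
     if 2 * r + index_degree \<alpha> \<beta> = m \<and> \<alpha> \<noteq> \<beta> then wcoef (exp_ad S (H U)) r \<alpha> \<beta> / H2_eigenvalue v1 v2 \<alpha> \<beta> else 0)"

text \<open>
  Corrections start in degree three, so after \<open>n\<close> steps the degrees up to \<open>n + 2\<close> are settled.
\<close>

primrec approx_generator :: "symb \<Rightarrow> nat \<Rightarrow> symb" where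
  "approx_generator U 0 = 0"
| "approx_generator U (Suc n) =
     approx_generator U n + correction U (n + 3) (approx_generator U n)"

lemma deg_ge_correction: "deg_ge m (correction U m S)"
  by (simp add: deg_ge_iff_wcoef correction_def wcoef_zseries)

lemma deg_ge_approx_generator: "deg_ge 3 (approx_generator U n)"
  by (induction n) (auto intro!: deg_ge_linear deg_ge_mono[OF deg_ge_correction])

lemma approx_generator_stable: "deg_ge (n + 3) (approx_generator U (n + k) - approx_generator U n)"
proof (induction k)
  case (Suc k)
  have "deg_ge (n + 3) (correction U (n + k + 3) (approx_generator U (n + k)))"
    by (rule deg_ge_mono[OF deg_ge_correction]) simp
  from deg_ge_linear(1)[OF Suc this] show ?case by (simp add: algebra_simps)
qed simp

lemma approx_generator_normal:
  assumes "deg_ge 3 U" "2 * r + index_degree \<alpha> \<beta> < n + 3" "\<alpha> \<noteq> \<beta>"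
  shows "wcoef (exp_ad (approx_generator U n) (H U)) r \<alpha> \<beta> = 0"
  using assms(2)
proof (induction n)
  case 0
  then show ?case
    using wcoef_deg_ge[of 3 U r \<alpha> \<beta>] assms by (simp add: exp_ad_0 wcoef_H2_nonresonant)
next
  case (Suc n)
  let ?S = "approx_generator U n" and ?T = "correction U (n + 3) (approx_generator U n)"
  have "deg_ge (Suc (n + 3)) (exp_ad (?S + ?T) (H U) - exp_ad ?S (H U) - (U - U - H2_bracket' (?S + ?T - ?S)))"
    using deg_ge_approx_generator[of U "Suc n"] deg_ge_approx_generator[of U n]
    by (intro first_order assms(1)) (auto simp: deg_ge_correction)
  then have "wcoef (exp_ad (?S + ?T) (H U) - exp_ad ?S (H U) - (U - U - H2_bracket' (?S + ?T - ?S))) r \<alpha> \<beta> = 0"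
    by (rule wcoef_deg_ge) (use Suc.prems in simp)
  then have *: "wcoef (exp_ad (?S + ?T) (H U)) r \<alpha> \<beta> =
      wcoef (exp_ad ?S (H U)) r \<alpha> \<beta> - H2_eigenvalue v1 v2 \<alpha> \<beta> * wcoef ?T r \<alpha> \<beta>"
    by (simp add: wcoef_H2_bracket algebra_simps)
  have "H2_eigenvalue v1 v2 \<alpha> \<beta> \<noteq> 0" using H2_eigenvalue_eq_0 assms(3) by blast
  then show ?case
    using * Suc assms(3) by (cases "2 * r + index_degree \<alpha> \<beta> = n + 3") (auto simp: correction_def wcoef_zseries)
qed

text \<open>
  The coefficients of the approximate generators become stationary. For a coefficient of degree \<open>d\<close> the
  approximation with index \<open>d\<close> is already late enough.
\<close>

lemma generator_exists:
  assumes U: "deg_ge 3 U"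
  shows "\<exists>S. qbnf_generator (H U) S"
proof -
  define S where "S = zseries (\<lambda>r \<alpha> \<beta>. wcoef (approx_generator U (2 * r + index_degree \<alpha> \<beta>)) r \<alpha> \<beta>)"
  have S_approx: "deg_ge (n + 3) (S - approx_generator U n)" for n
    unfolding deg_ge_iff_wcoef
  proof (intro allI impI)
    fix r \<alpha> \<beta> assume *: "2 * r + index_degree \<alpha> \<beta> < n + 3"
    define d where "d = 2 * r + index_degree \<alpha> \<beta>"
    have "wcoef (approx_generator U d) r \<alpha> \<beta> = wcoef (approx_generator U n) r \<alpha> \<beta>"
    proof (cases "d \<le> n")
      case True
      with wcoef_deg_ge[OF approx_generator_stable[of d U "n - d"], of r \<alpha> \<beta>] show ?thesis
        by (simp add: d_def)
    next
      case False
      with wcoef_deg_ge[OF approx_generator_stable[of n U "d - n"], of r \<alpha> \<beta>] * show ?thesis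
        by (simp add: d_def)
    qed
    then show "wcoef (S - approx_generator U n) r \<alpha> \<beta> = 0"
      by (simp add: S_def wcoef_zseries d_def)
  qed
  have S3: "deg_ge 3 S" using S_approx[of 0] by simp
  have "wcoef S r \<alpha> \<alpha> = 0" for r \<alpha>
  proof -
    have "wcoef (approx_generator U n) r \<alpha> \<alpha> = 0" for n
      by (induction n) (simp_all add: correction_def wcoef_zseries)
    then show ?thesis by (simp add: S_def wcoef_zseries)
  qed
  moreover have "wcoef (exp_ad S (H U)) r \<alpha> \<beta> = 0" if "\<alpha> \<noteq> \<beta>" for r \<alpha> \<beta>
  proof -
    let ?n = "2 * r + index_degree \<alpha> \<beta>"
    have "deg_ge (Suc (?n + 3)) (exp_ad S (H U) - exp_ad (approx_generator U ?n) (H U) -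
        (U - U - H2_bracket' (S - approx_generator U ?n)))"
      using S3 deg_ge_approx_generator by (intro first_order U) (auto intro: S_approx)
    then have "wcoef (exp_ad S (H U) - exp_ad (approx_generator U ?n) (H U) -
        (U - U - H2_bracket' (S - approx_generator U ?n))) r \<alpha> \<beta> = 0"
      by (rule wcoef_deg_ge) simp
    moreover have "wcoef (S - approx_generator U ?n) r \<alpha> \<beta> = 0"
      by (rule wcoef_deg_ge[OF S_approx]) simp
    ultimately show ?thesis
      using approx_generator_normal[OF U _ that, of r ?n] by (simp add: wcoef_H2_bracket)
  qed
  ultimately have "qbnf_generator (H U) S"
    using S3 by (simp add: qbnf_generator_iff)
  then show ?thesis ..
qed

lemma generator_unique:
  assumes "deg_ge 3 U" "qbnf_generator (H U) S" "qbnf_generator (H U) S'"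
  shows "S = S'"
  using deg_ge_all_imp_0[of "S - S'"] generators_agree[OF assms(1,1,2,3)] by simp

lemma qbnf_eq:
  assumes "deg_ge 3 U" "qbnf_generator (H U) S"
  shows "qbnf (H U) = exp_ad S (H U)"
proof -
  have "(THE S. qbnf_generator (H U) S) = S"
    using assms generator_unique by (intro the_equality)
  then show ?thesis by (simp add: qbnf_def)
qed

text \<open>
  The pure oscillator is in normal form. This allows \<open>S\<close> to be compared with \<open>0\<close> and \<open>U\<close> with \<open>0\<close>.
\<close>

lemma generator_0: "qbnf_generator (H 0) 0"
  by (simp add: qbnf_generator_iff exp_ad_0 wcoef_H2_nonresonant)

text \<open>
  In degree three there are no resonances, so the homological equation holds exactly: the cubic part of
  \<open>U\<close> is removed entirely.
\<close>

lemma generator_cubic_part: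
  assumes U: "deg_ge 3 U" and S: "qbnf_generator (H U) S"
  shows "deg_ge 4 (U - H2_bracket' S)"
  unfolding deg_ge_iff_wcoef
proof (intro allI impI)
  fix r \<alpha> \<beta> assume *: "2 * r + index_degree \<alpha> \<beta> < 4"
  note gen = S[unfolded qbnf_generator_iff]
  have S3: "deg_ge 3 S" using gen by blast
  show "wcoef (U - H2_bracket' S) r \<alpha> \<beta> = 0"
  proof (cases "2 * r + index_degree \<alpha> \<beta> < 3")
    case True
    then show ?thesis using wcoef_deg_ge[OF U] wcoef_deg_ge[OF S3] by (simp add: wcoef_H2_bracket)
  next
    case False
    with * have "2 * r + index_degree \<alpha> \<beta> = 3" by simp
    then have "\<alpha> \<noteq> \<beta>" by (auto simp: index_degree_def) presburger
    have "deg_ge (Suc 3) (exp_ad S (H U) - exp_ad 0 (H 0) - (U - 0 - H2_bracket' (S - 0)))"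
      by (rule first_order) (use U S3 in auto)
    then have "wcoef (exp_ad S (H U) - exp_ad 0 (H 0) - (U - 0 - H2_bracket' (S - 0))) r \<alpha> \<beta> = 0"
      by (rule wcoef_deg_ge) (use * in simp)
    moreover have "wcoef (exp_ad S (H U)) r \<alpha> \<beta> = 0" "wcoef (exp_ad 0 (H 0)) r \<alpha> \<beta> = 0"
      using gen generator_0 \<open>\<alpha> \<noteq> \<beta>\<close> unfolding qbnf_generator_iff by blast+
    ultimately show ?thesis by simp
  qed
qed

text \<open>
  Expansion of the exponential to second order. The term \<open>ad\<^sub>S ad\<^sub>S H\<^sub>2 / 2\<close> is \<open>- ad\<^sub>S U / 2\<close> in degree
  four and cancels half of \<open>ad\<^sub>S U\<close>.
\<close>

lemma qbnf_quartic_part: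
  assumes U: "deg_ge 3 U" and S: "qbnf_generator (H U) S"
  shows "deg_ge 5 (exp_ad S (H U) - (H2 v1 v2 + U - H2_bracket' S + scal (1 / 2) * ad_over_hbar S U))"
proof -
  have S3: "deg_ge 3 S" using S by (simp add: qbnf_generator_iff)
  have "deg_ge (Suc (Suc 3)) (exp_ad S (H U) - exp_ad 0 (H 0) -
     (H U - H 0 + (ad_over_hbar S (H U - H 0) + ad_over_hbar (S - 0) (H 0)) +
      scal (1 / 2) * (ad_over_hbar S (ad_over_hbar (S - 0) (H 0)) +
        ad_over_hbar (S - 0) (ad_over_hbar 0 (H 0)))))"
    by (rule exp_ad_diff_second_order) (use U S3 deg_ge_H2 in auto)
  moreover have "deg_ge (Suc (Suc 3)) (scal (1 / 2) * ad_over_hbar S (U - H2_bracket' S))"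
    using deg_ge_ad[OF S3 generator_cubic_part[OF U S]] by (intro deg_ge_linear) simp
  ultimately have "deg_ge (Suc (Suc 3)) (exp_ad S (H U) - exp_ad 0 (H 0) -
     (H U - H 0 + (ad_over_hbar S (H U - H 0) + ad_over_hbar (S - 0) (H 0)) +
      scal (1 / 2) * (ad_over_hbar S (ad_over_hbar (S - 0) (H 0)) +
        ad_over_hbar (S - 0) (ad_over_hbar 0 (H 0))))
     + scal (1 / 2) * ad_over_hbar S (U - H2_bracket' S))" (is "deg_ge _ ?X")
    by (rule deg_ge_linear)
  moreover have "?X = exp_ad S (H U) - (H2 v1 v2 + U - H2_bracket' S + scal (1 / 2) * ad_over_hbar S U)"
    by (rule symb_eqI) (simp add: exp_ad_0 ad_H2 ad_linear ad_minus H2_bracket_0; simp add: field_simps)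
  ultimately have "deg_ge (Suc (Suc 3))
      (exp_ad S (H U) - (H2 v1 v2 + U - H2_bracket' S + scal (1 / 2) * ad_over_hbar S U))"
    by (simp only:)
  then show ?thesis by simp
qed

text \<open>
  The difference of two normal forms in the two lowest degrees. The error consists of brackets with
  \<open>U' - {S', H\<^sub>2}\<close>, which starts in degree four, of terms with too many brackets, and of terms quadratic in the
  differences; these start in degree \<open>2 m - 2\<close>, whence the bound \<open>m \<ge> 4\<close>. The derivation property of
  \<open>{_, H\<^sub>2}\<close> turns \<open>ad\<close> of \<open>S - S'\<close> on \<open>{S', H\<^sub>2}\<close>, up to a bracket with \<open>H\<^sub>2\<close>, into \<open>ad\<close> of \<open>S'\<close> on
  \<open>{S - S', H\<^sub>2}\<close>, and this is how the total bracket with \<open>H\<^sub>2\<close> on the right arises.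
\<close>

lemma second_order:
  assumes U: "deg_ge 3 U" "deg_ge 3 U'"
    and S: "qbnf_generator (H U) S" "qbnf_generator (H U') S'"
    and u: "deg_ge m (U - U')" and m: "m \<ge> 4"
  shows "deg_ge (m + 2) (exp_ad S (H U) - exp_ad S' (H U') -
    (U - U' - H2_bracket' (S - S') + ad_over_hbar S' (U - U')
      + scal (1 / 2) * H2_bracket' (ad_over_hbar (S - S') S')))"
proof -
  have S3: "deg_ge 3 S" "deg_ge 3 S'" using S by (simp_all add: qbnf_generator_iff)
  define \<delta> where "\<delta> = S - S'"
  define w where "w = U - U'"
  have \<delta>: "deg_ge m \<delta>" unfolding \<delta>_def by (rule generators_agree[OF U S u])
  have w: "deg_ge m w" using u by (simp add: w_def)
  have Seq: "S = S' + \<delta>" and Ueq: "U = U' + w" by (simp_all add: \<delta>_def w_def)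
  let ?X = "exp_ad S (H U) - exp_ad S' (H U') -
     (H U - H U' + (ad_over_hbar S (H U - H U') + ad_over_hbar (S - S') (H U')) +
      scal (1 / 2) * (ad_over_hbar S (ad_over_hbar (S - S') (H U')) +
        ad_over_hbar (S - S') (ad_over_hbar S' (H U'))))"
  have X: "deg_ge (m + 2) ?X"
    using exp_ad_diff_second_order[of S S' "H U'" m "H U"] S3 U deg_ge_H m u \<delta> by (simp add: \<delta>_def)
  have f1: "deg_ge (m + 2) (ad_over_hbar S (ad_over_hbar \<delta> U'))"
    using deg_ge_ad[OF S3(1) deg_ge_ad[OF \<delta> U(2)]] by (rule deg_ge_mono) simp
  have f2: "deg_ge (m + 2) (ad_over_hbar \<delta> (ad_over_hbar S' U'))"
    using deg_ge_ad[OF \<delta> deg_ge_ad[OF S3(2) U(2)]] by (rule deg_ge_mono) simp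
  have f3: "deg_ge (m + 2) (ad_over_hbar \<delta> (U' - H2_bracket' S'))"
    using deg_ge_ad[OF \<delta> generator_cubic_part[OF U(2) S(2)]] by (rule deg_ge_mono) simp
  have f4: "deg_ge (m + 2) (ad_over_hbar \<delta> w)" "deg_ge (m + 2) (ad_over_hbar \<delta> (H2_bracket' \<delta>))"
    using m by (auto intro: deg_ge_mono[OF deg_ge_ad[OF \<delta> w]]
        deg_ge_mono[OF deg_ge_ad[OF \<delta> deg_ge_H2_bracket[OF \<delta>]]])
  \<comment> \<open>The derivation property and \<open>S = S' + \<delta>\<close> identify the difference between the expansion and the claim
    as a combination of the negligible terms above.\<close>
  have "deg_ge (m + 2) (?X + (ad_over_hbar \<delta> w + ad_over_hbar \<delta> (U' - H2_bracket' S') +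
      scal (1 / 2) * (ad_over_hbar S (ad_over_hbar \<delta> U') + ad_over_hbar \<delta> (ad_over_hbar S' U') -
        ad_over_hbar \<delta> (H2_bracket' \<delta>))))" (is "deg_ge _ ?Y")
    by (intro deg_ge_linear X f1 f2 f3 f4)
  moreover have "?Y = exp_ad S (H U) - exp_ad S' (H U') -
    (w - H2_bracket' \<delta> + ad_over_hbar S' w + scal (1 / 2) * H2_bracket' (ad_over_hbar \<delta> S'))"
    unfolding H2_bracket_ad Seq Ueq ad_swap[of "H2_bracket' \<delta>" S']
    by (rule symb_eqI) (simp add: ad_H2 ad_linear ad_minus; simp add: field_simps)
  ultimately have "deg_ge (m + 2) (exp_ad S (H U) - exp_ad S' (H U') -
    (w - H2_bracket' \<delta> + ad_over_hbar S' w + scal (1 / 2) * H2_bracket' (ad_over_hbar \<delta> S')))"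
    by (simp only:)
  then show ?thesis by (simp only: \<delta>_def w_def)
qed

end

section \<open>Symbols without Planck constant and without momenta\<close>

definition classical :: "symb \<Rightarrow> bool" where
  "classical A \<longleftrightarrow> (\<forall>r a1 a2 b1 b2. r \<noteq> 0 \<longrightarrow> coef A r a1 a2 b1 b2 = 0)"

lemma classical_linear:
  "classical A \<Longrightarrow> classical B \<Longrightarrow> classical (A + B)"
  "classical A \<Longrightarrow> classical B \<Longrightarrow> classical (A - B)"
  "classical A \<Longrightarrow> classical (scal c * A)"
  by (simp_all add: classical_def)

lemma classical_mult: "classical A \<Longrightarrow> classical B \<Longrightarrow> classical (A * B)"
  unfolding classical_def coef_mult
  by (intro allI impI sum.neutral ballI) (metis diff_zero mult_eq_0_iff)

lemma classical_generators: "classical X1" "classical X2" "classical Xi1" "classical Xi2"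
  by (simp_all add: classical_def coef_def X1_def X2_def Xi1_def Xi2_def)

lemma classical_d:
  "classical A \<Longrightarrow> classical (dX1 A)" "classical A \<Longrightarrow> classical (dX2 A)"
  "classical A \<Longrightarrow> classical (dXi1 A)" "classical A \<Longrightarrow> classical (dXi2 A)"
  by (simp_all add: classical_def)

lemma classical_bidiff: "classical A \<Longrightarrow> classical B \<Longrightarrow> classical (bidiff j A B)"
proof (induction j arbitrary: A B)
  case (Suc j)
  show ?case
    unfolding bidiff.simps by (intro classical_linear Suc.IH classical_d Suc.prems)
qed (simp add: classical_mult)

text \<open>
  The \<open>z\<close>-coefficients of order \<open>r\<close> in \<open>\<hbar>\<close> depend only on the coefficient of \<open>\<hbar>\<^sup>r\<close>.
\<close>

lemma wcoef_scaled:
  assumes "\<And>a1 a2 b1 b2. coef A r a1 a2 b1 b2 = k * coef B s a1 a2 b1 b2"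
  shows "wcoef A r \<alpha> \<beta> = k * wcoef B s \<alpha> \<beta>"
proof -
  have "\<forall>A B. (\<forall>a1 a2 b1 b2. coef A r a1 a2 b1 b2 = k * coef B s a1 a2 b1 b2) \<longrightarrow>
      wcoef A r \<alpha> \<beta> = k * wcoef B s \<alpha> \<beta>"
  proof (induction \<alpha> \<beta> rule: multi_index_induct)
    case 1
    then show ?case by (simp add: wcoef_0)
  next
    case (2 a1 a2 b1 b2)
    show ?case
    proof (intro allI impI)
      fix A B assume "\<forall>a1 a2 b1 b2. coef A r a1 a2 b1 b2 = k * coef B s a1 a2 b1 b2"
      then have "\<forall>a1 a2 b1 b2. coef (wz1 A) r a1 a2 b1 b2 = k * coef (wz1 B) s a1 a2 b1 b2"
        by (simp add: wirtinger_defs; simp add: algebra_simps)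
      with 2 show "wcoef A r (Suc a1, a2) (b1, b2) = k * wcoef B s (Suc a1, a2) (b1, b2)"
        by (simp add: wcoef_Suc del: of_nat_Suc)
    qed
  next
    case (3 a1 a2 b1 b2)
    show ?case
    proof (intro allI impI)
      fix A B assume "\<forall>a1 a2 b1 b2. coef A r a1 a2 b1 b2 = k * coef B s a1 a2 b1 b2"
      then have "\<forall>a1 a2 b1 b2. coef (wz2 A) r a1 a2 b1 b2 = k * coef (wz2 B) s a1 a2 b1 b2"
        by (simp add: wirtinger_defs; simp add: algebra_simps)
      with 3 show "wcoef A r (a1, Suc a2) (b1, b2) = k * wcoef B s (a1, Suc a2) (b1, b2)"
        by (simp add: wcoef_Suc del: of_nat_Suc)
    qed
  next
    case (4 a1 a2 b1 b2)
    show ?case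
    proof (intro allI impI)
      fix A B assume "\<forall>a1 a2 b1 b2. coef A r a1 a2 b1 b2 = k * coef B s a1 a2 b1 b2"
      then have "\<forall>a1 a2 b1 b2. coef (wb1 A) r a1 a2 b1 b2 = k * coef (wb1 B) s a1 a2 b1 b2"
        by (simp add: wirtinger_defs; simp add: algebra_simps)
      with 4 show "wcoef A r (a1, a2) (Suc b1, b2) = k * wcoef B s (a1, a2) (Suc b1, b2)"
        by (simp add: wcoef_Suc del: of_nat_Suc)
    qed
  next
    case (5 a1 a2 b1 b2)
    show ?case
    proof (intro allI impI)
      fix A B assume "\<forall>a1 a2 b1 b2. coef A r a1 a2 b1 b2 = k * coef B s a1 a2 b1 b2"
      then have "\<forall>a1 a2 b1 b2. coef (wb2 A) r a1 a2 b1 b2 = k * coef (wb2 B) s a1 a2 b1 b2"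
        by (simp add: wirtinger_defs; simp add: algebra_simps)
      with 5 show "wcoef A r (a1, a2) (b1, Suc b2) = k * wcoef B s (a1, a2) (b1, Suc b2)"
        by (simp add: wcoef_Suc del: of_nat_Suc)
    qed
  qed
  then show ?thesis using assms by blast
qed

lemma wcoef_classical:
  assumes "classical A" "r \<noteq> 0"
  shows "wcoef A r \<alpha> \<beta> = 0"
  using wcoef_scaled[of A r 0 A 0] assms by (simp add: classical_def)

text \<open>
  For classical symbols the order \<open>\<hbar>\<^sup>3\<close> of the Moyal commutator comes from the third power of the
  bidifferential operator alone; \<open>1 / 24 = \<i> (\<i> / 2)\<^sup>3 / 3! * 2\<close>.
\<close>

lemma wcoef_ad_classical:
  assumes "classical A" "classical B"
  shows "wcoef (ad_over_hbar A B) 2 \<alpha> \<beta> = wcoef (bidiff 3 A B) 0 \<alpha> \<beta> / 24"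
proof -
  have "coef (ad_over_hbar A B) 2 a1 a2 b1 b2 = 1 / 24 * coef (bidiff 3 A B) 0 a1 a2 b1 b2"
    for a1 a2 b1 b2
  proof -
    have cl: "coef (bidiff j A B) i a1 a2 b1 b2 = 0" "coef (bidiff j B A) i a1 a2 b1 b2 = 0"
      if "i \<noteq> 0" for i j
      using classical_bidiff[OF assms] classical_bidiff[OF assms(2,1)] that by (simp_all add: classical_def)
    have "{..Suc 2} = {0, 1, 2, 3::nat}" by auto
    moreover have "coef (bidiff 3 B A) 0 a1 a2 b1 b2 = - coef (bidiff 3 A B) 0 a1 a2 b1 b2"
      using bidiff_swap[of 3 B A] by simp
    ultimately show ?thesis
      unfolding coef_ad by (simp add: cl power3_eq_cube fact_numeral del: bidiff.simps)
  qed
  then show ?thesis using wcoef_scaled[of "ad_over_hbar A B" 2 "1 / 24" "bidiff 3 A B" 0] by simp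
qed

definition momentum_free :: "symb \<Rightarrow> bool" where
  "momentum_free A \<longleftrightarrow> dXi1 A = 0 \<and> dXi2 A = 0"

lemma momentum_free_d:
  "momentum_free A \<Longrightarrow> momentum_free (dX1 A)" "momentum_free A \<Longrightarrow> momentum_free (dX2 A)"
  by (simp_all add: momentum_free_def d_commute)

lemma momentum_free_linear:
  "momentum_free A \<Longrightarrow> momentum_free B \<Longrightarrow> momentum_free (A + B)"
  "momentum_free A \<Longrightarrow> momentum_free B \<Longrightarrow> momentum_free (A - B)"
  "momentum_free A \<Longrightarrow> momentum_free (scal c * A)"
  by (simp_all add: momentum_free_def)

text \<open>
  On functions of the positions both Wirtinger derivatives in a coordinate equal half the
  derivative in that coordinate.
\<close>

lemma wcoef_momentum_free:
  assumes "momentum_free A"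
  shows "wcoef A r (a1, a2) (b1, b2) =
    fact (a1 + b1) * fact (a2 + b2) / (2 ^ (a1 + a2 + b1 + b2) * fact a1 * fact a2 * fact b1 * fact b2)
    * coef A r (a1 + b1) (a2 + b2) 0 0"
proof -
  have "\<forall>A. momentum_free A \<longrightarrow> wcoef A r \<alpha> \<beta> =
      fact (fst \<alpha> + fst \<beta>) * fact (snd \<alpha> + snd \<beta>) /
        (2 ^ index_degree \<alpha> \<beta> * fact (fst \<alpha>) * fact (snd \<alpha>) * fact (fst \<beta>) * fact (snd \<beta>))
      * coef A r (fst \<alpha> + fst \<beta>) (snd \<alpha> + snd \<beta>) 0 0" for \<alpha> \<beta>
  proof (induction \<alpha> \<beta> rule: multi_index_induct)
    case 1
    then show ?case by (simp add: wcoef_0 index_degree_def)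
  next
    case (2 a1 a2 b1 b2)
    then show ?case
      by (auto simp: wcoef_Suc wirtinger_defs momentum_free_def d_commute index_degree_def simp del: of_nat_Suc;
        simp add: divide_simps del: of_nat_Suc; simp add: mult_ac del: of_nat_Suc)
  next
    case (3 a1 a2 b1 b2)
    then show ?case
      by (auto simp: wcoef_Suc wirtinger_defs momentum_free_def d_commute index_degree_def simp del: of_nat_Suc;
        simp add: divide_simps del: of_nat_Suc; simp add: mult_ac del: of_nat_Suc)
  next
    case (4 a1 a2 b1 b2)
    then show ?case
      by (auto simp: wcoef_Suc wirtinger_defs momentum_free_def d_commute index_degree_def simp del: of_nat_Suc;
        simp add: divide_simps del: of_nat_Suc; simp add: mult_ac del: of_nat_Suc)
  next
    case (5 a1 a2 b1 b2)
    then show ?case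
      by (auto simp: wcoef_Suc wirtinger_defs momentum_free_def d_commute index_degree_def simp del: of_nat_Suc;
        simp add: divide_simps del: of_nat_Suc; simp add: mult_ac del: of_nat_Suc)
  qed
  from this[of "(a1, a2)" "(b1, b2)"] assms show ?thesis by (simp add: index_degree_def)
qed

text \<open>
  The resonant part of \<open>x\<^sub>1\<^sup>2\<^sup>p x\<^sub>2\<^sup>2\<^sup>q\<close> is a nonzero multiple of \<open>\<Omega>\<^sub>1\<^sup>p \<Omega>\<^sub>2\<^sup>q\<close>.
\<close>

lemma wcoef_momentum_free_eq_0_iff:
  assumes "momentum_free A"
  shows "wcoef A r (p, q) (p, q) = 0 \<longleftrightarrow> coef A r (2 * p) (2 * q) 0 0 = 0"
  using wcoef_momentum_free[OF assms, of r p q p q] by (simp add: mult_2)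

lemma bidiff_momentum_free:
  assumes "momentum_free B"
  shows "bidiff (Suc j) A B = - bidiff j (dXi1 A) (dX1 B) - bidiff j (dXi2 A) (dX2 B)"
  using assms by (simp add: momentum_free_def)

section \<open>The cubic part of the generator\<close>

text \<open>
  The solution of \<open>{s, H\<^sub>2} = a x\<^sub>1\<^sup>3 + b x\<^sub>1 x\<^sub>2\<^sup>2\<close>. Comparing coefficients on the span of
  \<open>x\<^sub>1\<^sup>2 \<xi>\<^sub>1, \<xi>\<^sub>1\<^sup>3\<close> and of \<open>x\<^sub>1 x\<^sub>2 \<xi>\<^sub>2, x\<^sub>2\<^sup>2 \<xi>\<^sub>1, \<xi>\<^sub>1 \<xi>\<^sub>2\<^sup>2\<close> gives two linear systems; the determinant of
  the second one contains the factor \<open>v\<^sub>1\<^sup>2 - 4 v\<^sub>2\<^sup>2\<close>.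
\<close>

definition cubic_generator :: "real \<Rightarrow> real \<Rightarrow> real \<Rightarrow> real \<Rightarrow> symb" where
  "cubic_generator v1 v2 a b =
     (let C = 2 * v2\<^sup>2 * b / (v1 * (v1\<^sup>2 - 4 * v2\<^sup>2)); A = v1 * C / v2; B = C - v1 * A / (2 * v2) in
      scal (of_real (- a / v1)) * (X1 * X1 * Xi1) + scal (of_real (- 2 * a / (3 * v1))) * (Xi1 * Xi1 * Xi1)
      + scal (of_real A) * (X1 * X2 * Xi2) + scal (of_real B) * (X2 * X2 * Xi1)
      + scal (of_real C) * (Xi1 * Xi2 * Xi2))"

lemma H2_bracket_generators:
  "H2_bracket v1 v2 X1 = scal (of_real v1) * Xi1" "H2_bracket v1 v2 X2 = scal (of_real v2) * Xi2"
  "H2_bracket v1 v2 Xi1 = - (scal (of_real v1) * X1)" "H2_bracket v1 v2 Xi2 = - (scal (of_real v2) * X2)"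
  "H2_bracket v1 v2 (scal c) = 0"
  by (simp_all add: H2_bracket_def)

lemma H2_bracket_cubic_generator:
  assumes "v1 \<noteq> 0" "v2 \<noteq> 0" "v1\<^sup>2 - 4 * v2\<^sup>2 \<noteq> 0"
  shows "H2_bracket v1 v2 (cubic_generator v1 v2 a b) =
    scal (of_real a) * (X1 * X1 * X1) + scal (of_real b) * (X1 * X2 * X2)"
proof -
  define C where "C = 2 * v2\<^sup>2 * b / (v1 * (v1\<^sup>2 - 4 * v2\<^sup>2))"
  define A where "A = v1 * C / v2"
  define B where "B = C - v1 * A / (2 * v2)"
  have e1: "v1 * C = v2 * A" using assms by (simp add: A_def)
  have e2: "2 * (v2 * B) = 2 * (v2 * C) - v1 * A" using assms by (simp add: B_def field_simps)
  have e3: "- v1 * B - v2 * A = b"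
  proof -
    have "v1 * C * (v1\<^sup>2 - 4 * v2\<^sup>2) = 2 * v2\<^sup>2 * b" using assms by (simp add: C_def)
    moreover have "- v1 * B - v2 * A = v1 * C * (v1\<^sup>2 - 4 * v2\<^sup>2) / (2 * v2\<^sup>2)"
      using assms unfolding B_def A_def by (simp add: field_simps power2_eq_square)
    ultimately show ?thesis using assms by simp
  qed
  have s: "cubic_generator v1 v2 a b = scal (of_real (- a / v1)) * (X1 * X1 * Xi1)
      + scal (of_real (- 2 * a / (3 * v1))) * (Xi1 * Xi1 * Xi1)
      + scal (of_real A) * (X1 * X2 * Xi2) + scal (of_real B) * (X2 * X2 * Xi1)
      + scal (of_real C) * (Xi1 * Xi2 * Xi2)"
    by (simp only: cubic_generator_def Let_def C_def A_def B_def)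
  define P where "P = - a / v1"
  define Q where "Q = - 2 * a / (3 * v1)"
  \<comment> \<open>Multiples are written as sums, so that they distribute over the embedding of the scalars.\<close>
  have e0: "v1 * P = - a" "v1 * (Q + Q + Q) = v1 * (P + P)"
    using assms by (simp_all add: P_def Q_def)
  have "H2_bracket v1 v2 (cubic_generator v1 v2 a b) =
      scal (of_real (- (v1 * P))) * (X1 * X1 * X1) + scal (of_real (- (v1 * B) - v2 * A)) * (X1 * X2 * X2)
      + scal (of_real (v1 * (P + P) - v1 * (Q + Q + Q))) * (X1 * Xi1 * Xi1)
      + scal (of_real (v2 * A - v1 * C)) * (X1 * Xi2 * Xi2)
      + scal (of_real (v1 * A + (v2 * B + v2 * B) - (v2 * C + v2 * C))) * (X2 * Xi1 * Xi2)"
    unfolding s P_def[symmetric] Q_def[symmetric] H2_bracket_linear H2_bracket_mult H2_bracket_generators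
      of_real_add of_real_diff of_real_mult of_real_minus scal_add scal_diff scal_mult scal_minus
    by (simp add: algebra_simps)
  also have "\<dots> = scal (of_real a) * (X1 * X1 * X1) + scal (of_real b) * (X1 * X2 * X2)"
  proof -
    have "- (v1 * P) = a" "- (v1 * B) - v2 * A = b" "v1 * (P + P) - v1 * (Q + Q + Q) = 0"
      "v2 * A - v1 * C = 0" "v1 * A + (v2 * B + v2 * B) - (v2 * C + v2 * C) = 0"
      using e0 e1 e2 e3 by linarith+
    then show ?thesis by (simp only: of_real_0 scal_0 mult_zero_left add_0_right)
  qed
  finally show ?thesis .
qed

lemma d_cubic_generator:
  "dXi1 (dXi1 (dXi1 (cubic_generator v1 v2 a b))) = scal (of_real (- 4 * a / v1))"
  "dXi2 (dXi2 (dXi1 (cubic_generator v1 v2 a b))) = scal (of_real (4 * v2\<^sup>2 * b / (v1 * (v1\<^sup>2 - 4 * v2\<^sup>2))))"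
  "dXi2 (dXi1 (dXi1 (cubic_generator v1 v2 a b))) = 0"
  "dXi2 (dXi2 (dXi2 (cubic_generator v1 v2 a b))) = 0"
  by (rule symb_eqI; simp add: cubic_generator_def Let_def d_mult coef_scal coef_1 coef_numeral; simp add: field_simps)+

lemma classical_cubic_generator: "classical (cubic_generator v1 v2 a b)"
  unfolding cubic_generator_def Let_def
  by (intro classical_linear classical_mult classical_generators)

lemma deg_ge_cubic_generator: "deg_ge 3 (cubic_generator v1 v2 a b)"
  unfolding cubic_generator_def Let_def
  by (intro deg_ge_linear deg_ge_mult3 deg_ge_generators)

text \<open>
  On a function of the positions only the part \<open>(- \<partial>\<^sub>\<xi> \<cdot> \<partial>\<^sub>y)\<^sup>3\<close> of the bidifferential operator
  acts, and it meets a cubic symbol in its constant third derivatives. Those of odd order in \<open>\<xi>\<^sub>2\<close> vanish by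
  the reflection symmetry.
\<close>

lemma bidiff3_cubic_generator:
  assumes "momentum_free u"
  shows "bidiff 3 (cubic_generator v1 v2 a b) u =
    scal (of_real (4 * a / v1)) * dX1 (dX1 (dX1 u))
    - scal (of_real (12 * v2\<^sup>2 * b / (v1 * (v1\<^sup>2 - 4 * v2\<^sup>2)))) * dX1 (dX2 (dX2 u))"
proof -
  define c where "c = 4 * v2\<^sup>2 * b / (v1 * (v1\<^sup>2 - 4 * v2\<^sup>2))"
  have c3: "12 * v2\<^sup>2 * b / (v1 * (v1\<^sup>2 - 4 * v2\<^sup>2)) = c + c + c"
    by (simp add: c_def)
  have a: "- 4 * a / v1 = - (4 * a / v1)" by simp
  note d = d_cubic_generator[of v1 v2 a b, folded c_def, unfolded a d_commute]
  show ?thesis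
    unfolding c3 of_real_add scal_add
    by (simp only: numeral_3_eq_3 bidiff_momentum_free momentum_free_d assms bidiff.simps(1) d_commute d
        of_real_minus scal_minus) (simp add: algebra_simps)
qed

lemma classical_H2: "classical (H2 v1 v2)"
  unfolding H2_def power2_eq_square
  by (intro classical_linear classical_mult classical_generators)

lemma coef_X_monomials:
  "coef (X1 * X1 * X1) r a1 a2 b1 b2 = (if r = 0 \<and> a1 = 3 \<and> a2 = 0 \<and> b1 = 0 \<and> b2 = 0 then 1 else 0)"
  "coef (X1 * X2 * X2) r a1 a2 b1 b2 = (if r = 0 \<and> a1 = 1 \<and> a2 = 2 \<and> b1 = 0 \<and> b2 = 0 then 1 else 0)"
proof -
  have "X1 * X1 * X1 = X1 * (X1 * (X1 * 1))" "X1 * X2 * X2 = X1 * (X2 * (X2 * 1))"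
    by (simp_all add: mult.assoc)
  then show "coef (X1 * X1 * X1) r a1 a2 b1 b2 =
      (if r = 0 \<and> a1 = 3 \<and> a2 = 0 \<and> b1 = 0 \<and> b2 = 0 then 1 else 0)"
    "coef (X1 * X2 * X2) r a1 a2 b1 b2 =
      (if r = 0 \<and> a1 = 1 \<and> a2 = 2 \<and> b1 = 0 \<and> b2 = 0 then 1 else 0)"
    by (auto simp only: coef_X1_mult coef_X2_mult coef_1 split: if_splits)
qed

context nonresonant
begin

text \<open>
  In degree three the homological equation has only one solution.
\<close>

lemma generator_cubic_agree:
  assumes "deg_ge 3 U" "qbnf_generator (H U) S" "deg_ge 3 s" "deg_ge 4 (U - H2_bracket' s)"
  shows "deg_ge 4 (S - s)"
  unfolding deg_ge_iff_wcoef
proof (intro allI impI)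
  fix r \<alpha> \<beta> assume *: "2 * r + index_degree \<alpha> \<beta> < 4"
  have S3: "deg_ge 3 S" using assms(2) by (simp add: qbnf_generator_iff)
  show "wcoef (S - s) r \<alpha> \<beta> = 0"
  proof (cases "2 * r + index_degree \<alpha> \<beta> < 3")
    case True
    then show ?thesis using wcoef_deg_ge[OF S3] wcoef_deg_ge[OF assms(3)] by simp
  next
    case False
    with * have "2 * r + index_degree \<alpha> \<beta> = 3" by simp
    then have "\<alpha> \<noteq> \<beta>" by (auto simp: index_degree_def) presburger
    have "wcoef (U - H2_bracket' S) r \<alpha> \<beta> = 0" "wcoef (U - H2_bracket' s) r \<alpha> \<beta> = 0"
      using wcoef_deg_ge[OF generator_cubic_part[OF assms(1,2)] *] wcoef_deg_ge[OF assms(4) *] by blast+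
    then have "H2_eigenvalue v1 v2 \<alpha> \<beta> * wcoef (S - s) r \<alpha> \<beta> = 0"
      by (simp add: wcoef_H2_bracket right_diff_distrib)
    then show ?thesis using H2_eigenvalue_eq_0[of \<alpha> \<beta>] \<open>\<alpha> \<noteq> \<beta>\<close> by (metis mult_eq_0_iff)
  qed
qed

lemma v_nonzero: "v1 \<noteq> 0" "v2 \<noteq> 0" "v1\<^sup>2 - 4 * v2\<^sup>2 \<noteq> 0"
proof -
  show "v1 \<noteq> 0" using H2_eigenvalue_eq_0[of "(1, 0)" "(0, 0)"] by (auto simp: H2_eigenvalue_def)
  show "v2 \<noteq> 0" using H2_eigenvalue_eq_0[of "(0, 1)" "(0, 0)"] by (auto simp: H2_eigenvalue_def)
  have "v1 - 2 * v2 \<noteq> 0"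
  proof
    assume "v1 - 2 * v2 = 0"
    then have "v1 = 2 * v2" by simp
    then show False using H2_eigenvalue_eq_0[of "(1, 0)" "(0, 2)"] by (auto simp: H2_eigenvalue_def)
  qed
  moreover have "v1 + 2 * v2 \<noteq> 0"
  proof
    assume "v1 + 2 * v2 = 0"
    then have "v1 = - 2 * v2" by simp
    then show False using H2_eigenvalue_eq_0[of "(1, 2)" "(0, 0)"] by (auto simp: H2_eigenvalue_def)
  qed
  moreover have "v1\<^sup>2 - 4 * v2\<^sup>2 = (v1 - 2 * v2) * (v1 + 2 * v2)"
    by (simp add: power2_eq_square algebra_simps)
  ultimately show "v1\<^sup>2 - 4 * v2\<^sup>2 \<noteq> 0" by simp
qed

section \<open>Reading the potential off the normal form\<close>

text \<open>
  In degree four, \<open>H\<^sub>2\<close> and \<open>U\<close> do not involve \<open>\<hbar>\<close> and \<open>{S, H\<^sub>2}\<close> is not resonant, so the coefficient of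
  \<open>\<hbar>\<^sup>2\<close> is that of \<open>ad\<^sub>S U / 2\<close>, where only the cubic parts of \<open>S\<close> and \<open>U\<close> count.
\<close>

lemma qbnf_h2_origin:
  assumes U: "deg_ge 3 U" "classical U" "momentum_free U"
    and cubic: "deg_ge 4 (U - (scal (of_real a) * (X1 * X1 * X1) + scal (of_real b) * (X1 * X2 * X2)))"
    and S: "qbnf_generator (H U) S"
  shows "wcoef (exp_ad S (H U)) 2 (0, 0) (0, 0) =
     of_real (a\<^sup>2 / (2 * v1) - v2\<^sup>2 * b\<^sup>2 / (2 * v1 * (v1\<^sup>2 - 4 * v2\<^sup>2)))"
proof -
  let ?s = "cubic_generator v1 v2 a b"
  have S3: "deg_ge 3 S" using S by (simp add: qbnf_generator_iff)
  have Ss: "deg_ge 4 (S - ?s)"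
    using cubic v_nonzero by (intro generator_cubic_agree[OF U(1) S] deg_ge_cubic_generator)
      (simp add: H2_bracket_cubic_generator)
  have "wcoef (exp_ad S (H U)) 2 (0, 0) (0, 0) =
      wcoef (H2 v1 v2 + U - H2_bracket' S + scal (1 / 2) * ad_over_hbar S U) 2 (0, 0) (0, 0)"
    using wcoef_deg_ge[OF qbnf_quartic_part[OF U(1) S], of 2 "(0, 0)" "(0, 0)"] by (simp add: index_degree_def)
  also have "\<dots> = 1 / 2 * wcoef (ad_over_hbar S U) 2 (0, 0) (0, 0)"
    using wcoef_classical[OF classical_H2] wcoef_classical[OF U(2)] by (simp add: wcoef_H2_bracket H2_eigenvalue_def)
  also have "wcoef (ad_over_hbar S U) 2 (0, 0) (0, 0) = wcoef (ad_over_hbar ?s U) 2 (0, 0) (0, 0)"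
    using wcoef_deg_ge[OF deg_ge_ad[OF Ss U(1)], of 2 "(0, 0)" "(0, 0)"] by (simp add: ad_linear index_degree_def)
  also have "\<dots> = coef (bidiff 3 ?s U) 0 0 0 0 0 / 24"
    by (subst wcoef_ad_classical[OF classical_cubic_generator U(2)]) (simp only: wcoef_0)
  also have "coef (bidiff 3 ?s U) 0 0 0 0 0 =
      of_real (4 * a / v1) * (6 * coef U 0 3 0 0 0)
      - of_real (12 * v2\<^sup>2 * b / (v1 * (v1\<^sup>2 - 4 * v2\<^sup>2))) * (2 * coef U 0 1 2 0 0)"
    unfolding bidiff3_cubic_generator[OF U(3)] by (simp add: eval_nat_numeral)
  also have "coef U 0 3 0 0 0 = of_real a"
    using deg_geD[OF cubic, of 0 3 0 0 0] by (simp add: coef_X_monomials)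
  also have "coef U 0 1 2 0 0 = of_real b"
    using deg_geD[OF cubic, of 0 1 2 0 0] by (simp add: coef_X_monomials)
  finally have "wcoef (exp_ad S (H U)) 2 (0, 0) (0, 0) = of_real (1 / 2 * ((4 * a / v1 * (6 * a)
      - 12 * v2\<^sup>2 * b / (v1 * (v1\<^sup>2 - 4 * v2\<^sup>2)) * (2 * b)) / 24))"
    by simp
  moreover have "1 / 2 * ((4 * a / v1 * (6 * a) - 12 * v2\<^sup>2 * b / (v1 * d) * (2 * b)) / 24) =
      a\<^sup>2 / (2 * v1) - v2\<^sup>2 * b\<^sup>2 / (2 * v1 * d)" if "d \<noteq> 0" for d :: real
    using that v_nonzero(1) by (simp add: field_simps power2_eq_square)
  note this[OF v_nonzero(3)]
  ultimately show ?thesis by (simp only:)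
qed

text \<open>
  The layer \<open>b\<^sub>0\<close> in even degree \<open>m\<close>: of the leading term \<open>u - {S - S', H\<^sub>2}\<close> only \<open>u\<close> is resonant.
\<close>

lemma even_degree_step:
  assumes U: "deg_ge 3 U" "deg_ge 3 U'" and S: "qbnf_generator (H U) S" "qbnf_generator (H U') S'"
    and u: "deg_ge m (U - U')" "momentum_free (U - U')" and m: "m \<ge> 3" "2 * p + 2 * q = m"
    and agree: "wcoef (exp_ad S (H U)) 0 (p, q) (p, q) = wcoef (exp_ad S' (H U')) 0 (p, q) (p, q)"
  shows "coef (U - U') 0 (2 * p) (2 * q) 0 0 = 0"
proof -
  have S3: "deg_ge 3 S" "deg_ge 3 S'" using S by (simp_all add: qbnf_generator_iff)
  have "deg_ge (Suc m) (exp_ad S (H U) - exp_ad S' (H U') - (U - U' - H2_bracket' (S - S')))"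
    by (rule first_order[OF S3 U(2) m(1) generators_agree[OF U S u(1)] u(1)])
  then have "wcoef (U - U') 0 (p, q) (p, q) = 0"
    using wcoef_deg_ge[of "Suc m" _ 0 "(p, q)" "(p, q)"] m(2) agree
    by (fastforce simp: index_degree_def wcoef_H2_bracket H2_eigenvalue_def)
  then show ?thesis using wcoef_momentum_free_eq_0_iff[OF u(2)] by blast
qed

text \<open>
  The layer \<open>b\<^sub>1\<close> in degree \<open>m + 1\<close>: since \<open>u\<close> is classical and brackets with \<open>H\<^sub>2\<close> are not resonant, only
  \<open>{s, u}\<^sub>3 / 24\<close> contributes to the order \<open>\<hbar>\<^sup>2\<close>. It is free of momenta, so the vanishing of its resonant
  coefficient is a linear relation between two coefficients of \<open>u\<close>, in which the factor \<open>4 a / v\<^sub>1\<close> of the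
  first one is nonzero.
\<close>

lemma odd_degree_step:
  assumes U: "deg_ge 3 U" "deg_ge 3 U'" and S: "qbnf_generator (H U) S" "qbnf_generator (H U') S'"
    and u: "deg_ge m (U - U')" "momentum_free (U - U')" "classical (U - U')"
    and cubic: "deg_ge 4 (U' - (scal (of_real a) * (X1 * X1 * X1) + scal (of_real b) * (X1 * X2 * X2)))"
    and a: "a \<noteq> 0"
    and m: "m \<ge> 4" "2 * p + 2 * q + 3 = m"
    and agree: "wcoef (exp_ad S (H U)) 2 (p, q) (p, q) = wcoef (exp_ad S' (H U')) 2 (p, q) (p, q)"
    and previous: "coef (U - U') 0 (2 * p + 1) (2 * q + 2) 0 0 = 0"
  shows "coef (U - U') 0 (2 * p + 3) (2 * q) 0 0 = 0"
proof -
  let ?s = "cubic_generator v1 v2 a b" and ?u = "U - U'"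
  have Ss: "deg_ge 4 (S' - ?s)"
    using cubic v_nonzero by (intro generator_cubic_agree[OF U(2) S(2)] deg_ge_cubic_generator)
      (simp add: H2_bracket_cubic_generator)
  have "wcoef (exp_ad S (H U) - exp_ad S' (H U') -
      (U - U' - H2_bracket' (S - S') + ad_over_hbar S' (U - U')
      + scal (1 / 2) * H2_bracket' (ad_over_hbar (S - S') S'))) 2 (p, q) (p, q) = 0"
    by (rule wcoef_deg_ge[OF second_order[OF U S u(1) m(1)]]) (use m in \<open>simp add: index_degree_def\<close>)
  then have "wcoef (ad_over_hbar S' ?u) 2 (p, q) (p, q) = 0"
    using agree wcoef_classical[OF u(3), of 2] by (simp add: wcoef_H2_bracket H2_eigenvalue_def)
  moreover have "wcoef (ad_over_hbar S' ?u) 2 (p, q) (p, q) = wcoef (ad_over_hbar ?s ?u) 2 (p, q) (p, q)"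
    using wcoef_deg_ge[OF deg_ge_ad[OF Ss u(1)], of 2 "(p, q)" "(p, q)"] m by (simp add: ad_linear(2) index_degree_def)
  ultimately have z: "wcoef (bidiff 3 ?s ?u) 0 (p, q) (p, q) = 0"
    using wcoef_ad_classical[OF classical_cubic_generator u(3)] by simp
  have "momentum_free (bidiff 3 ?s ?u)"
    unfolding bidiff3_cubic_generator[OF u(2)] by (intro momentum_free_linear momentum_free_d u(2))
  with z have "coef (bidiff 3 ?s ?u) 0 (2 * p) (2 * q) 0 0 = 0"
    by (simp only: wcoef_momentum_free_eq_0_iff)
  then have "of_real (4 * a / v1) * (of_nat (Suc (2 * p)) * (of_nat (Suc (Suc (2 * p))) *
      (of_nat (Suc (Suc (Suc (2 * p)))) * coef ?u 0 (2 * p + 3) (2 * q) 0 0))) = 0"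
    using previous unfolding bidiff3_cubic_generator[OF u(2)]
    by (simp add: eval_nat_numeral del: of_nat_Suc of_real_divide)
  then show ?thesis using a v_nonzero(1) by (simp del: of_nat_Suc)
qed

end

section \<open>From potentials to formal symbols\<close>

lemma coef_X_power_mult:
  "coef (X1 ^ j * A) r a1 a2 b1 b2 = (if a1 < j then 0 else coef A r (a1 - j) a2 b1 b2)"
  "coef (X2 ^ k * A) r a1 a2 b1 b2 = (if a2 < k then 0 else coef A r a1 (a2 - k) b1 b2)"
  by (simp_all add: coef_def X1_def X2_def fps_const_power fps_X_power_mult_nth)

lemma coef_U_series:
  "coef (U_series v1 v2 V) r a1 a2 b1 b2 =
     (if r = 0 \<and> b1 = 0 \<and> b2 = 0 \<and> even a2 \<and> a1 + a2 \<ge> 3 then of_real (ncoef v1 v2 V a1 a2) else 0)"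
proof -
  let ?F = "\<lambda>(j, k). if j + 2 * k \<ge> 3
     then scal (of_real (ncoef v1 v2 V j (2 * k))) * X1 ^ j * X2 ^ (2 * k) else 0"
  have F: "coef (?F i) r a1 a2 b1 b2 = (if i = (a1, a2 div 2) \<and> r = 0 \<and> b1 = 0 \<and> b2 = 0 \<and> even a2 \<and> a1 + a2 \<ge> 3
      then of_real (ncoef v1 v2 V a1 a2) else 0)" for i
  proof -
    obtain j k where i: "i = (j, k)" by (cases i)
    have "coef (X1 ^ j * (X2 ^ (2 * k) * 1)) r a1 a2 b1 b2 =
        (if r = 0 \<and> a1 = j \<and> a2 = 2 * k \<and> b1 = 0 \<and> b2 = 0 then 1 else 0)"
      unfolding coef_X_power_mult coef_1 by auto
    then show ?thesis by (auto simp: i mult.assoc)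
  qed
  show ?thesis
    unfolding U_series_def fsum_def coef_symb_of F
    by (auto simp: Collect_conv_if split: if_splits)
qed

lemma deg_ge_U_series: "deg_ge 3 (U_series v1 v2 V)"
  by (auto simp: deg_ge_def coef_U_series)

lemma classical_U_series: "classical (U_series v1 v2 V)"
  by (auto simp: classical_def coef_U_series)

lemma momentum_free_U_series: "momentum_free (U_series v1 v2 V)"
  unfolding momentum_free_def by (auto intro!: symb_eqI simp: coef_U_series)

lemma U_series_cubic_part:
  "deg_ge 4 (U_series v1 v2 V - (scal (of_real (ncoef v1 v2 V 3 0)) * (X1 * X1 * X1)
     + scal (of_real (ncoef v1 v2 V 1 2)) * (X1 * X2 * X2)))"
  unfolding deg_ge_def
proof (intro allI impI)
  fix r a1 a2 b1 b2 :: nat assume "2 * r + a1 + a2 + b1 + b2 < 4"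
  moreover from this have "a1 = 3 \<and> a2 = 0 \<or> a1 = 1 \<and> a2 = 2" if "even a2" "a1 + a2 \<ge> 3"
    using that by presburger
  ultimately show "coef (U_series v1 v2 V - (scal (of_real (ncoef v1 v2 V 3 0)) * (X1 * X1 * X1)
     + scal (of_real (ncoef v1 v2 V 1 2)) * (X1 * X2 * X2))) r a1 a2 b1 b2 = 0"
    by (cases "even a2 \<and> a1 + a2 \<ge> 3") (auto simp: coef_U_series coef_X_monomials)
qed

lemma frequencies_nonresonant:
  assumes "v1 > 0" "v2 > 0" "v1 / v2 \<notin> \<rat>"
  shows "nonresonant v1 v2"
proof
  fix \<alpha> \<beta> :: "nat \<times> nat"
  assume "H2_eigenvalue v1 v2 \<alpha> \<beta> = 0"
  define k where "k = int (fst \<beta>) - int (fst \<alpha>)"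
  define l where "l = int (snd \<beta>) - int (snd \<alpha>)"
  have "complex_of_real (v1 * of_int k + v2 * of_int l) = 0"
    using \<open>H2_eigenvalue v1 v2 \<alpha> \<beta> = 0\<close> by (simp add: H2_eigenvalue_def k_def l_def)
  then have eq: "v1 * of_int k + v2 * of_int l = 0" by (simp only: of_real_eq_0_iff)
  have "k = 0"
  proof (rule ccontr)
    assume "k \<noteq> 0"
    then have "v1 / v2 = - of_int l / of_int k" using eq assms by (simp add: field_simps)
    also have "\<dots> \<in> \<rat>" by simp
    finally show False using assms(3) by simp
  qed
  with eq assms(2) have "l = 0" by simp
  with \<open>k = 0\<close> show "\<alpha> = \<beta>" by (simp add: k_def l_def prod_eq_iff)
qed

text \<open>
  The normal derivatives of \<open>V\<close> of odd order are odd in \<open>q\<^sub>2\<close> and vanish on the reflection axis, along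
  which the remaining derivatives are taken.
\<close>

lemma taylor_odd_eq_0:
  assumes V: "symmetric_well V" and m: "odd m"
  shows "taylor V j m = 0"
proof -
  have sym: "(pd2 ^^ n) V (x, - y) = (- 1) ^ n * (pd2 ^^ n) V (x, y)" for n x y
  proof (induction n arbitrary: x y)
    case 0
    then show ?case using V by (simp add: symmetric_well_def)
  next
    case (Suc n)
    let ?f = "\<lambda>t. (pd2 ^^ n) V (x, t)"
    have smooth: "Ck k ((pd2 ^^ n) V)" for k n
    proof (induction n arbitrary: k)
      case 0
      then show ?case using V by (simp add: symmetric_well_def smooth_def)
    next
      case (Suc n)
      show ?case using Suc.IH[of "Suc k"] unfolding Ck.simps by simp
    qed
    have "(\<lambda>t. ?f t) differentiable (at t)" for t
    proof -
      have "(pd2 ^^ n) V differentiable (at (x, t))"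
        using smooth[of "Suc 0" n] by simp
      then have "((pd2 ^^ n) V \<circ> (\<lambda>t. (x, t))) differentiable (at t)"
        by (intro differentiable_chain_at) (auto intro!: differentiable_Pair)
      then show ?thesis by (simp add: o_def)
    qed
    then have D: "(?f has_field_derivative deriv ?f t) (at t)" for t
      using DERIV_deriv_iff_real_differentiable by blast
    have "((\<lambda>t. ?f (- t)) has_field_derivative deriv ?f (- y) * (- 1)) (at y)"
      by (rule DERIV_chain2[OF D]) (auto intro!: derivative_eq_intros)
    moreover have "((\<lambda>t. ?f (- t)) has_field_derivative (- 1) ^ n * deriv ?f y) (at y)"
      unfolding Suc.IH by (intro DERIV_cmult D)
    ultimately have "deriv ?f (- y) * (- 1) = (- 1) ^ n * deriv ?f y"
      by (rule DERIV_unique)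
    then show ?case by (simp add: pd2_def[of "(pd2 ^^ n) V"])
  qed
  have axis: "(pd2 ^^ m) V (x, 0) = 0" for x
    using sym[of m x 0] m by simp
  have "(pd1 ^^ j) ((pd2 ^^ m) V) (x, 0) = 0" for x
    by (induction j arbitrary: x) (simp_all add: axis pd1_def)
  then show ?thesis by (simp add: taylor_def)
qed

lemma taylor_low_order:
  assumes V: "symmetric_well V"
  shows "taylor V 0 0 = 0" "taylor V (Suc 0) 0 = 0"
proof -
  show "taylor V 0 0 = 0" using V by (simp add: taylor_def symmetric_well_def)
  let ?f = "\<lambda>t. V (t, 0)"
  have "V differentiable (at (0, 0))"
    using V unfolding symmetric_well_def smooth_def by (metis Ck.simps(2))
  then have "(V \<circ> (\<lambda>t. (t, 0))) differentiable (at 0)"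
    by (intro differentiable_chain_at) (auto intro!: differentiable_Pair)
  then have "(?f has_field_derivative deriv ?f 0) (at 0)"
    using DERIV_deriv_iff_real_differentiable by (auto simp: o_def)
  moreover have "?f 0 \<le> ?f t" for t
    using V unfolding symmetric_well_def by (cases "t = 0") (auto intro: less_imp_le)
  ultimately have "deriv ?f 0 = 0"
    by (intro DERIV_local_min[of ?f _ 0 1]) auto
  then show "taylor V (Suc 0) 0 = 0" by (simp add: taylor_def pd1_def)
qed

lemma taylor_eq_if_ncoef_eq:
  assumes "v1 > 0" "v2 > 0" "ncoef v1 v2 W j m = ncoef v1 v2 V j m"
  shows "taylor W j m = taylor V j m"
  using assms by (simp add: ncoef_def)

context nonresonant
begin

lemma qbnf_coef_eq:
  assumes "qbnf_generator (H (U_series v1 v2 V)) S"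
  shows "qbnf_coef v1 v2 V r k l = wcoef (exp_ad S (H (U_series v1 v2 V))) (2 * r) (k, l) (k, l)"
  by (simp add: qbnf_coef_def hamiltonian_def qbnf_eq[OF deg_ge_U_series assms] zcoef_eq_wcoef)

lemma qbnf_coef_1_0_0:
  "qbnf_coef v1 v2 V 1 0 0 = of_real ((ncoef v1 v2 V 3 0)\<^sup>2 / (2 * v1)
     - v2\<^sup>2 * (ncoef v1 v2 V 1 2)\<^sup>2 / (2 * v1 * (v1\<^sup>2 - 4 * v2\<^sup>2)))"
proof -
  obtain S where S: "qbnf_generator (H (U_series v1 v2 V)) S"
    using generator_exists[OF deg_ge_U_series] by blast
  show ?thesis
    using qbnf_h2_origin[OF deg_ge_U_series classical_U_series momentum_free_U_series U_series_cubic_part S]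
    by (simp add: qbnf_coef_eq[OF S])
qed

lemma cubic_coefficient_formula:
  "complex_of_real ((ncoef v1 v2 V 3 0)\<^sup>2) = 2 * complex_of_real v1 * qbnf_coef v1 v2 V 1 0 0
     + complex_of_real (v2\<^sup>2 / (v1\<^sup>2 - 4 * v2\<^sup>2) * (ncoef v1 v2 V 1 2)\<^sup>2)"
proof -
  have "a\<^sup>2 = 2 * v1 * (a\<^sup>2 / (2 * v1) - v2\<^sup>2 * b\<^sup>2 / (2 * v1 * d)) + v2\<^sup>2 / d * b\<^sup>2"
    if "d \<noteq> 0" for a b d :: real
    using that v_nonzero(1) by (simp add: field_simps)
  note this[OF v_nonzero(3), of "ncoef v1 v2 V 3 0" "ncoef v1 v2 V 1 2"]
  then have "complex_of_real ((ncoef v1 v2 V 3 0)\<^sup>2) = complex_of_real (2 * v1 *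
      ((ncoef v1 v2 V 3 0)\<^sup>2 / (2 * v1) - v2\<^sup>2 * (ncoef v1 v2 V 1 2)\<^sup>2 / (2 * v1 * (v1\<^sup>2 - 4 * v2\<^sup>2)))
      + v2\<^sup>2 / (v1\<^sup>2 - 4 * v2\<^sup>2) * (ncoef v1 v2 V 1 2)\<^sup>2)"
    by (simp only:)
  then show ?thesis
    unfolding qbnf_coef_1_0_0 by (simp only: of_real_add of_real_mult of_real_numeral)
qed

text \<open>
  Induction on the degree in which the two potentials agree. Degree three uses the formula for \<open>a\<^sub>3\<^sub>0\<^sup>2\<close>;
  in odd degrees a second induction increases the power of \<open>x\<^sub>1\<close> by two at each step, starting from the
  prescribed row \<open>a\<^sub>1\<^sub>,\<^sub>2\<^sub>k\<close>.
\<close>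

lemma ncoef_determined:
  assumes a30: "ncoef v1 v2 V 3 0 \<noteq> 0"
    and sign: "sgn (ncoef v1 v2 W 3 0) = sgn (ncoef v1 v2 V 3 0)"
    and a1: "\<And>k. k \<ge> 1 \<Longrightarrow> ncoef v1 v2 W 1 (2 * k) = ncoef v1 v2 V 1 (2 * k)"
    and b0: "\<And>k l. k + l \<ge> 2 \<Longrightarrow> qbnf_coef v1 v2 W 0 k l = qbnf_coef v1 v2 V 0 k l"
    and b1: "\<And>k l. qbnf_coef v1 v2 W 1 k l = qbnf_coef v1 v2 V 1 k l"
    and jk: "j + 2 * k \<ge> 3"
  shows "ncoef v1 v2 W j (2 * k) = ncoef v1 v2 V j (2 * k)"
proof -
  let ?U = "U_series v1 v2 W" and ?U' = "U_series v1 v2 V"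
  define u where "u = ?U - ?U'"
  obtain S where S: "qbnf_generator (H ?U) S" using generator_exists[OF deg_ge_U_series] by blast
  obtain S' where S': "qbnf_generator (H ?U') S'" using generator_exists[OF deg_ge_U_series] by blast
  have B0: "wcoef (exp_ad S (H ?U)) 0 (p, q) (p, q) = wcoef (exp_ad S' (H ?U')) 0 (p, q) (p, q)"
    if "p + q \<ge> 2" for p q
    using b0[OF that] qbnf_coef_eq[OF S, of 0] qbnf_coef_eq[OF S', of 0] by simp
  have B1: "wcoef (exp_ad S (H ?U)) 2 (p, q) (p, q) = wcoef (exp_ad S' (H ?U')) 2 (p, q) (p, q)" for p q
    using b1[of p q] qbnf_coef_eq[OF S, of 1] qbnf_coef_eq[OF S', of 1] by simp
  have u_mf: "momentum_free u" and u_cl: "classical u"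
    unfolding u_def by (intro momentum_free_linear classical_linear momentum_free_U_series classical_U_series)+
  have coef_u: "coef u r a1 a2 b1 b2 =
     (if r = 0 \<and> b1 = 0 \<and> b2 = 0 \<and> even a2 \<and> a1 + a2 \<ge> 3
      then of_real (ncoef v1 v2 W a1 a2 - ncoef v1 v2 V a1 a2) else 0)" for r a1 a2 b1 b2
    by (simp add: u_def coef_U_series)
  have next_degree: "deg_ge (Suc m) u" if m: "deg_ge m u"
    and top: "\<And>i k. i + 2 * k = m \<Longrightarrow> coef u 0 i (2 * k) 0 0 = 0" for m
    unfolding deg_ge_def
  proof (intro allI impI)
    fix r a1 a2 b1 b2 assume "2 * r + a1 + a2 + b1 + b2 < Suc m"
    then consider "2 * r + a1 + a2 + b1 + b2 < m" | "2 * r + a1 + a2 + b1 + b2 = m" by linarith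
    then show "coef u r a1 a2 b1 b2 = 0"
    proof cases
      case 1
      then show ?thesis using m by (rule deg_geD[rotated])
    next
      case 2
      then show ?thesis using top[of a1 "a2 div 2"] coef_u[of r a1 a2 b1 b2] by auto
    qed
  qed
  have "deg_ge m u" if "m \<ge> 3" for m
    using that
  proof (induction m rule: dec_induct)
    case base
    show ?case unfolding u_def by (intro deg_ge_linear deg_ge_U_series)
  next
    case (step m)
    \<comment> \<open>For \<open>k = 0\<close> there is nothing to know: the potentials start in degree three.\<close>
    have odd_first: "coef u 0 1 (2 * k) 0 0 = 0" for k
      using a1[of k] by (cases k) (auto simp: coef_u)
    consider "m = 3" | "even m" | "odd m" "m \<ge> 4" using step.hyps by linarith
    then show ?case
    proof cases
      case 1
      have "complex_of_real ((ncoef v1 v2 W 3 0)\<^sup>2) = complex_of_real ((ncoef v1 v2 V 3 0)\<^sup>2)"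
        unfolding cubic_coefficient_formula b1 using a1[of 1] by simp
      then have "(ncoef v1 v2 W 3 0)\<^sup>2 = (ncoef v1 v2 V 3 0)\<^sup>2" by (simp only: of_real_eq_iff)
      then have "ncoef v1 v2 W 3 0 = ncoef v1 v2 V 3 0"
        using sign a30 by (auto simp: power2_eq_iff sgn_minus sgn_zero_iff)
      then have c3: "coef u 0 3 0 0 0 = 0" by (simp add: coef_u)
      show ?thesis
      proof (rule next_degree[OF step.IH])
        fix i k assume "i + 2 * k = m"
        with 1 have "i = 3 \<and> k = 0 \<or> i = 1" by presburger
        then show "coef u 0 i (2 * k) 0 0 = 0" using c3 odd_first by auto
      qed
    next
      case 2
      show ?thesis
      proof (rule next_degree[OF step.IH])
        fix i k assume ik: "i + 2 * k = m"
        with 2 obtain p where p: "i = 2 * p" by (metis even_add even_mult_iff even_numeral evenE)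
        have "coef (?U - ?U') 0 (2 * p) (2 * k) 0 0 = 0"
          by (rule even_degree_step[OF deg_ge_U_series deg_ge_U_series S S', of m])
            (use step.IH step.hyps u_mf ik p in \<open>auto simp: u_def intro!: B0\<close>)
        then show "coef u 0 i (2 * k) 0 0 = 0" by (simp add: u_def p)
      qed
    next
      case 3
      show ?thesis
      proof (rule next_degree[OF step.IH])
        fix i k assume ik: "i + 2 * k = m"
        have "coef u 0 (2 * p + 1) (2 * q) 0 0 = 0" if "2 * p + 1 + 2 * q = m" for p q
          using that
        proof (induction p arbitrary: q)
          case 0
          then show ?case using odd_first[of q] by simp
        next
          case (Suc p)
          have "coef (?U - ?U') 0 (2 * p + 3) (2 * q) 0 0 = 0"
          proof (rule odd_degree_step[OF deg_ge_U_series deg_ge_U_series S S' _ _ _ U_series_cubic_part a30])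
            show "deg_ge m (?U - ?U')" "momentum_free (?U - ?U')" "classical (?U - ?U')"
              using step.IH u_mf u_cl by (simp_all add: u_def)
            show "coef (?U - ?U') 0 (2 * p + 1) (2 * q + 2) 0 0 = 0"
              using Suc.IH[of "Suc q"] Suc.prems by (simp add: u_def)
          qed (use Suc.prems 3 B1 in auto)
          then show ?case by (simp add: u_def eval_nat_numeral)
        qed
        moreover obtain p where "i = 2 * p + 1" using ik 3 by (metis even_add even_mult_iff even_numeral oddE)
        ultimately show "coef u 0 i (2 * k) 0 0 = 0" using ik by simp
      qed
    qed
  qed
  then have "coef u 0 j (2 * k) 0 0 = 0" using deg_geD[of "Suc (j + 2 * k)" u 0 j "2 * k" 0 0] jk by simp
  then show ?thesis using jk by (simp add: coef_u flip: of_real_diff)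
qed

end

theorem theorem1p1:
  fixes V :: "real \<times> real \<Rightarrow> real" and v1 v2 :: real
  assumes "symmetric_well V"
    and "frequencies V v1 v2"
    and "v1 / v2 \<notin> \<rat>"
    and "ncoef v1 v2 V 3 0 \<noteq> 0"
  shows
    "(\<forall>W :: real \<times> real \<Rightarrow> real.
        symmetric_well W \<and> frequencies W v1 v2 \<and> ncoef v1 v2 W 3 0 \<noteq> 0 \<and>
        sgn (ncoef v1 v2 W 3 0) = sgn (ncoef v1 v2 V 3 0) \<and>
        (\<forall>k\<ge>1. ncoef v1 v2 W 1 (2 * k) = ncoef v1 v2 V 1 (2 * k)) \<and>
        (\<forall>k l. k + l \<ge> 2 \<longrightarrow> qbnf_coef v1 v2 W 0 k l = qbnf_coef v1 v2 V 0 k l) \<and>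
        (\<forall>k l. qbnf_coef v1 v2 W 1 k l = qbnf_coef v1 v2 V 1 k l)
      \<longrightarrow>
        (\<forall>j k. j + 2 * k \<ge> 3 \<longrightarrow> ncoef v1 v2 W j (2 * k) = ncoef v1 v2 V j (2 * k)) \<and>
        (\<forall>j m. taylor W j m = taylor V j m))
     \<and>
     complex_of_real ((ncoef v1 v2 V 3 0)\<^sup>2) =
       2 * complex_of_real v1 * qbnf_coef v1 v2 V 1 0 0
       + complex_of_real (v2\<^sup>2 / (v1\<^sup>2 - 4 * v2\<^sup>2) * (ncoef v1 v2 V 1 2)\<^sup>2)"
proof -
  have v: "v1 > 0" "v2 > 0" using assms(2) by (simp_all add: frequencies_def)
  interpret nonresonant v1 v2 using v assms(3) by (rule frequencies_nonresonant)
  have "(\<forall>j k. j + 2 * k \<ge> 3 \<longrightarrow> ncoef v1 v2 W j (2 * k) = ncoef v1 v2 V j (2 * k)) \<and>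
        (\<forall>j m. taylor W j m = taylor V j m)"
    if W: "symmetric_well W" "frequencies W v1 v2"
      "sgn (ncoef v1 v2 W 3 0) = sgn (ncoef v1 v2 V 3 0)"
      "\<forall>k\<ge>1. ncoef v1 v2 W 1 (2 * k) = ncoef v1 v2 V 1 (2 * k)"
      "\<forall>k l. k + l \<ge> 2 \<longrightarrow> qbnf_coef v1 v2 W 0 k l = qbnf_coef v1 v2 V 0 k l"
      "\<forall>k l. qbnf_coef v1 v2 W 1 k l = qbnf_coef v1 v2 V 1 k l" for W
  proof -
    have n: "ncoef v1 v2 W j (2 * k) = ncoef v1 v2 V j (2 * k)" if "j + 2 * k \<ge> 3" for j k
      by (rule ncoef_determined[OF assms(4) W(3)]) (use W(4-6) that in blast)+
    have "taylor W j m = taylor V j m" for j m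
    proof (cases "odd m")
      case True
      then show ?thesis using taylor_odd_eq_0 assms(1) W(1) by simp
    next
      case False
      then obtain k where m: "m = 2 * k" by blast
      consider "j + 2 * k \<ge> 3" | "j = 0" "k = 0" | "j = Suc 0" "k = 0" | "j = 2" "k = 0" | "j = 0" "k = 1"
        by linarith
      then show ?thesis
      proof cases
        case 1
        then show ?thesis using taylor_eq_if_ncoef_eq[OF v n] m by simp
      qed (use taylor_low_order[OF assms(1)] taylor_low_order[OF W(1)] assms(2) W(2) in
          \<open>simp_all add: m frequencies_def\<close>)
    qed
    with n show ?thesis by blast
  qed
  then show ?thesis using cubic_coefficient_formula[of V] by blast
qed

end
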